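(* Let $\Bbbk$ be an algebraically closed field and $q\in\Bbbk^*$, and let $D$ be the algebra defined in the context, with its subalgebras $A_q$ and $A_1$. Then every irreducible $D$ weight module is indecomposable as an $A_q$-module and indecomposable as an $A_1$-module.
   Context: Let $R=\Bbbk[\tau,\sigma,\sigma^{-1}]$ be the localization of the polynomial algebra $\Bbbk[\tau,\sigma]$ at the powers of $\sigma$, and let $\alpha:R\to R$ be the $\Bbbk$-algebra automorphism with $\alpha(\tau)=\tau-1$, $\alpha(\sigma)=\sigma/q$. $D$ is the $\Bbbk$-algebra generated over $R$ by $X,Y,Y_1$ subject to the relations $$YX=\tau,\quad XY=\alpha(\tau)=\tau-1,\quad Y_1X=q\sigma-1,\quad XY_1=\alpha(q\sigma-1)=\sigma-1,\quad Y_1(\tau-1)=Y(\sigma-1),$$ $$Xr=\alpha(r)X,\quad Yr=\alpha^{-1}(r)Y,\quad Y_1r=\alpha^{-1}(r)Y_1\qquad (r\in R).$$ $A_q$ is the $R$-subalgebra of $D$ generated by $X$ and $Y_1$; $A_1$ is the $R$-subalgebra of $D$ generated by $X$ and $Y$. For a module $M$ and a maximal ideal $\mathfrak m$ of $R$ put $M_{\mathfrak m}=\{v\in M\mid \mathfrak m v=0\}$. $M$ is a weight module if $M=\sum_{\mathfrak m\in \mathrm{Max}(R)}M_{\mathfrak m}$.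
   Formalization: The formal theorem additionally assumes that char k = 0 or q is not a root of unity (equivalently, α has infinite order); in positive characteristic with q a root of unity the claim is false for D as presented. *)

theory Defs
  imports "HOL-Algebra.Algebraic_Closure_Type" "HOL-Algebra.Generated_Rings"
    "HOL-Library.Poly_Mapping" "HOL-Library.Product_Plus"
begin

section \<open>The coefficient ring and its automorphism\<close>

text \<open>
  The localization \<open>k[\<tau>, \<sigma>, \<sigma>\<inverse>]\<close> as the monoid algebra of \<open>\<nat> \<times> \<int>\<close>: the pair
  \<open>(i, j)\<close> stands for the monomial \<open>\<tau>\<^sup>i \<sigma>\<^sup>j\<close>.
\<close>

type_synonym 'k coord = "(nat \<times> int) \<Rightarrow>\<^sub>0 'k"

definition const :: "'k::field \<Rightarrow> 'k coord"
  where "const c = Poly_Mapping.single (0, 0) c"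

definition tau :: "'k::field coord"
  where "tau = Poly_Mapping.single (1, 0) 1"

definition sigma :: "'k::field coord"
  where "sigma = Poly_Mapping.single (0, 1) 1"

definition sigma_inv :: "'k::field coord"
  where "sigma_inv = Poly_Mapping.single (0, -1) 1"

text \<open>The substitution \<open>\<tau> \<mapsto> \<tau> + c\<close>, \<open>\<sigma> \<mapsto> u \<sigma>\<close>.\<close>

definition affine_subst :: "'k::field \<Rightarrow> 'k \<Rightarrow> 'k coord \<Rightarrow> 'k coord"
  where "affine_subst c u p =
    (\<Sum>m\<in>Poly_Mapping.keys p. Poly_Mapping.single (0, snd m) (Poly_Mapping.lookup p m * u powi snd m)
                  * (tau + const c) ^ fst m)"

definition alpha :: "'k::field \<Rightarrow> 'k coord \<Rightarrow> 'k coord"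
  where "alpha q = affine_subst (-1) (inverse q)"

lemma zero_pair: "(0, 0) = (0 :: nat \<times> int)"
  by (simp add: zero_prod_def)

lemma const_0 [simp]: "const 0 = 0" by (simp add: const_def)
lemma const_1 [simp]: "const 1 = 1" by (simp add: const_def zero_pair)
lemma const_add: "const (a + b) = const a + const b"
  by (simp add: const_def single_add)
lemma const_mult: "const (a * b) = const a * const b"
  by (simp add: const_def mult_single)
lemma const_minus: "const (- a) = - const a"
  by (simp add: const_def single_uminus)

lemma sigma_inv: "sigma * sigma_inv = (1 :: 'k::field coord)"
  by (simp add: sigma_def sigma_inv_def mult_single zero_pair)

lemma tau_power: "tau ^ i = (Poly_Mapping.single (i, 0) 1 :: 'k::field coord)"
  by (induction i) (simp_all add: zero_pair tau_def mult_single)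

lemma sigma_power: "sigma ^ i = (Poly_Mapping.single (0, int i) 1 :: 'k::field coord)"
  by (induction i) (simp_all add: zero_pair sigma_def mult_single)

lemma coord_induct [case_names monom add]:
  fixes p :: "'k::field coord"
  assumes mon: "\<And>i j c. P (Poly_Mapping.single (i, j) c)"
    and add: "\<And>p p'. P p \<Longrightarrow> P p' \<Longrightarrow> P (p + p')"
  shows "P p"
proof (induction p rule: update_induct)
  case const
  then show ?case using mon[of 0 0 0] by simp
next
  case (update f a b)
  have "Poly_Mapping.update a b f = f + Poly_Mapping.single a b"
    using update.hyps
    by (intro poly_mapping_eqI) (auto simp: lookup_update lookup_add lookup_single in_keys_iff)
  then show ?case using add[OF update.IH mon[of "fst a" "snd a" b]] by simp
qed

text \<open>Every element is a polynomial divided by a power of \<open>\<sigma>\<close>.\<close>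

lemma coord_localization:
  fixes p :: "'k::field coord"
  shows "\<exists>n. \<forall>m\<in>Poly_Mapping.keys (sigma ^ n * p). 0 \<le> snd m"
proof (induction p rule: coord_induct)
  case (monom i j c)
  show ?case
    by (rule exI[of _ "nat (-j)"]) (auto simp: sigma_power mult_single)
next
  case (add p p')
  then obtain n n' where n: "\<forall>m\<in>Poly_Mapping.keys (sigma ^ n * p). 0 \<le> snd m"
    and n': "\<forall>m\<in>Poly_Mapping.keys (sigma ^ n' * p'). 0 \<le> snd m" by blast
  have *: "\<forall>m\<in>Poly_Mapping.keys (sigma ^ a * r). 0 \<le> snd m"
    if "\<forall>m\<in>Poly_Mapping.keys r. 0 \<le> snd m" for a and r :: "'k coord"
  proof
    fix m assume "m \<in> Poly_Mapping.keys (sigma ^ a * r)"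
    then obtain x y where "x \<in> Poly_Mapping.keys (sigma ^ a :: 'k coord)" "y \<in> Poly_Mapping.keys r" "m = x + y"
      using keys_mult[of "sigma ^ a" r] by blast
    then show "0 \<le> snd m" using that by (auto simp: sigma_power split: if_splits)
  qed
  have "sigma ^ (n + n') * (p + p') = sigma ^ n' * (sigma ^ n * p) + sigma ^ n * (sigma ^ n' * p')"
    by (simp add: power_add algebra_simps)
  then have "Poly_Mapping.keys (sigma ^ (n + n') * (p + p'))
      \<subseteq> Poly_Mapping.keys (sigma ^ n' * (sigma ^ n * p)) \<union> Poly_Mapping.keys (sigma ^ n * (sigma ^ n' * p'))"
    by (simp add: Poly_Mapping.keys_add)
  then show ?case using *[OF n, of n'] *[OF n', of n] by blast
qed

lemma affine_subst_superset:
  assumes "finite A" "Poly_Mapping.keys p \<subseteq> A"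
  shows "affine_subst c u p =
    (\<Sum>m\<in>A. Poly_Mapping.single (0, snd m) (Poly_Mapping.lookup p m * u powi snd m)
                  * (tau + const c) ^ fst m)"
  unfolding affine_subst_def
  by (rule sum.mono_neutral_left) (use assms in \<open>auto simp: in_keys_iff\<close>)

lemma affine_subst_add: "affine_subst c u (p + p') = affine_subst c u p + affine_subst c u p'"
proof -
  let ?A = "Poly_Mapping.keys p \<union> Poly_Mapping.keys p'"
  have "Poly_Mapping.keys (p + p') \<subseteq> ?A" by (rule Poly_Mapping.keys_add)
  then show ?thesis
    by (simp add: affine_subst_superset[of ?A] lookup_add distrib_right single_add sum.distrib)
qed

lemma affine_subst_single:
  "affine_subst c u (Poly_Mapping.single (i, j) a)
    = Poly_Mapping.single (0, j) (a * u powi j) * (tau + const c) ^ i"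
  by (subst affine_subst_superset[of "{(i, j)}"]) (auto simp: split: if_splits)

lemma affine_subst_const [simp]: "affine_subst c u (const a) = const a"
  by (simp add: const_def affine_subst_single)

lemma affine_subst_1 [simp]: "affine_subst c u 1 = 1"
  using affine_subst_const[of c u 1] by simp

lemma affine_subst_tau [simp]: "affine_subst c u tau = tau + const c"
  unfolding tau_def affine_subst_single by (simp add: zero_pair tau_def)

lemma affine_subst_sigma [simp]: "affine_subst c u sigma = const u * sigma"
  unfolding sigma_def affine_subst_single by (simp add: const_def mult_single)

lemma affine_subst_mult:
  assumes "u \<noteq> 0"
  shows "affine_subst c u (p * p') = affine_subst c u p * affine_subst c u p'"
proof (induction p rule: coord_induct)
  case (monom i j a)
  show ?case
  proof (induction p' rule: coord_induct)
    case (monom i' j' a')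
    have "Poly_Mapping.single (0, j) (a * u powi j) * Poly_Mapping.single (0, j') (a' * u powi j')
      = (Poly_Mapping.single (0, j + j') (a * a' * u powi (j + j')) :: 'a coord)"
      using assms by (simp add: mult_single power_int_add mult_ac add_ac)
    moreover have "S * T ^ (i + i') = (A * T ^ i) * (B * T ^ i')"
      if "A * B = S" for A B S T :: "'a coord"
      by (simp add: power_add mult_ac flip: that)
    ultimately show ?case
      by (simp only: mult_single affine_subst_single add_Pair)
  qed (simp add: affine_subst_add distrib_left)
qed (simp add: affine_subst_add distrib_right)

lemma coord_hom_eqI:
  fixes f g :: "'k::field coord \<Rightarrow> 'a::comm_ring_1"
  assumes "\<And>p p'. f (p + p') = f p + f p'" "\<And>p p'. g (p + p') = g p + g p'"
    and "\<And>p p'. f (p * p') = f p * f p'" "\<And>p p'. g (p * p') = g p * g p'"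
    and c: "\<And>a. f (const a) = g (const a)" and "f 1 = 1" "g 1 = 1"
    and t: "f tau = g tau" and s: "f sigma = g sigma"
  shows "f p = g p"
proof -
  have pow: "f (x ^ n) = f x ^ n" "g (x ^ n) = g x ^ n" for x n
    by (induction n) (simp_all add: assms)
  have "f sigma_inv = f sigma_inv * (g sigma * g sigma_inv)"
    by (metis assms(4) assms(7) sigma_inv mult.right_neutral)
  also have "\<dots> = (f sigma * f sigma_inv) * g sigma_inv" by (simp add: s mult_ac)
  also have "\<dots> = g sigma_inv" by (metis assms(3) assms(6) sigma_inv mult.left_neutral)
  finally have si: "f sigma_inv = g sigma_inv" .
  have sip: "sigma_inv ^ n = (Poly_Mapping.single (0, - int n) 1 :: 'k coord)" for n
    by (induction n) (simp_all add: zero_pair sigma_inv_def mult_single)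
  show ?thesis
  proof (induction p rule: coord_induct)
    case (monom i j a)
    have "Poly_Mapping.single (i, j) a = const a * tau ^ i * (sigma ^ nat j * sigma_inv ^ nat (-j))"
      by (simp add: const_def tau_power sigma_power sip mult_single)
    then show ?case by (simp only: assms pow si)
  qed (simp add: assms)
qed

lemma affine_subst_affine_subst:
  assumes "u \<noteq> 0" "v \<noteq> 0"
  shows "affine_subst c u (affine_subst d v p) = affine_subst (c + d) (u * v) p"
  by (rule coord_hom_eqI[where f = "\<lambda>p. affine_subst c u (affine_subst d v p)"
        and g = "affine_subst (c + d) (u * v)"])
     (simp_all add: assms affine_subst_add affine_subst_mult const_add const_mult algebra_simps)

lemma affine_subst_id: "affine_subst 0 1 p = p"
  by (rule coord_hom_eqI[where f = "affine_subst 0 1" and g = "\<lambda>p. p"])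
     (simp_all add: affine_subst_add affine_subst_mult)

lemma alpha_add: "alpha q (r + s) = alpha q r + alpha q s"
  by (simp add: alpha_def affine_subst_add)

lemma alpha_mult: "q \<noteq> 0 \<Longrightarrow> alpha q (r * s) = alpha q r * alpha q s"
  by (simp add: alpha_def affine_subst_mult)

lemma alpha_const: "alpha q (const c) = const c"
  by (simp add: alpha_def)

lemma alpha_tau: "alpha q tau = tau - 1"
  by (simp add: alpha_def const_minus)

lemma alpha_sigma: "alpha q sigma = const (inverse q) * sigma"
  by (simp add: alpha_def)

lemma inv_alpha:
  assumes "q \<noteq> 0"
  shows "inv_into UNIV (alpha q) = affine_subst 1 q"
  using assms
  by (intro inv_unique_comp)
     (auto simp: alpha_def fun_eq_iff affine_subst_affine_subst affine_subst_id)

lemma bij_alpha: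
  assumes "q \<noteq> 0"
  shows "bij (alpha q)"
  using assms
  by (intro o_bij[of "affine_subst 1 q"])
     (auto simp: alpha_def fun_eq_iff affine_subst_affine_subst affine_subst_id)


lemma alpha_funpow: "q \<noteq> 0 \<Longrightarrow> alpha q ^^ n = affine_subst (- of_nat n) (inverse q ^ n)"
proof (induction n)
  case 0
  show ?case by (simp add: fun_eq_iff affine_subst_id)
next
  case (Suc n)
  then show ?case
    by (simp add: fun_eq_iff alpha_def affine_subst_affine_subst)
qed

lemma affine_subst_eq_id_iff: "affine_subst c u = id \<longleftrightarrow> c = 0 \<and> u = (1 :: 'k::field)"
proof
  assume id: "affine_subst c u = id"
  have "tau + const c = tau"
    using affine_subst_tau[of c u] by (simp add: id)
  then have "Poly_Mapping.lookup (const c) (0, 0) = 0" by simp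
  moreover have "const u * sigma = sigma"
    using affine_subst_sigma[of c u] by (simp add: id)
  then have "Poly_Mapping.lookup (const u * sigma) (0, 1) = 1" by (simp add: sigma_def)
  ultimately show "c = 0 \<and> u = 1"
    by (simp add: const_def sigma_def mult_single)
qed (simp add: fun_eq_iff affine_subst_id)

text \<open>
  Why infinite order of \<open>\<alpha>\<close> matters. With the presentation of \<open>D\<close> below and \<open>\<alpha>\<close> of finite order,
  an irreducible weight module can decompose over \<open>A\<^sub>1\<close>. Let \<open>char k = 2\<close>, \<open>q = 1\<close>, \<open>V = k\<^sup>2\<close>
  and let \<open>M = V \<oplus> V\<close>, the summands having weights \<open>(\<tau> - 0, \<sigma> - 1)\<close> and \<open>(\<tau> - 1, \<sigma> - 1)\<close>,
  with \<open>X (v, w) = (w, 0)\<close>, \<open>Y (v, w) = (y w, v)\<close>, \<open>Y\<^sub>1 (v, w) = (z w, 0)\<close>, where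
  \<open>y (c, d) = (c, 0)\<close> and \<open>z (c, d) = (d, c)\<close>. All relations hold and \<open>M\<close> is irreducible
  over \<open>D\<close>, but over \<open>A\<^sub>1\<close> it splits along the two coordinates of \<open>V\<close>.
\<close>

lemma alpha_infinite_order_iff:
  assumes "(q :: 'k::field) \<noteq> 0"
  shows "(\<forall>n>0. alpha q ^^ n \<noteq> id) \<longleftrightarrow> CHAR('k) = 0 \<or> (\<forall>n>0. q ^ n \<noteq> 1)"
proof -
  have *: "alpha q ^^ n = id \<longleftrightarrow> CHAR('k) dvd n \<and> q ^ n = 1" for n
    using assms
    by (simp add: alpha_funpow affine_subst_eq_id_iff of_nat_eq_0_iff_char_dvd power_inverse)
  show ?thesis
  proof
    assume L: "\<forall>n>0. alpha q ^^ n \<noteq> id"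
    show "CHAR('k) = 0 \<or> (\<forall>n>0. q ^ n \<noteq> 1)"
    proof (rule ccontr)
      assume "\<not> ?thesis"
      then obtain n where n: "CHAR('k) > 0" "n > 0" "q ^ n = 1" by auto
      then have "alpha q ^^ (n * CHAR('k)) = id" by (simp add: * power_mult)
      then show False using L n by simp
    qed
  qed (auto simp: *)
qed


section \<open>The algebra D by generators and relations\<close>

text \<open>
  The free algebra on a set is the monoid algebra of the monoid of words.
\<close>

instantiation list :: (type) monoid_add
begin
definition zero_list :: "'a list" where "zero_list = []"
definition plus_list :: "'a list \<Rightarrow> 'a list \<Rightarrow> 'a list" where "plus_list = (@)"
instance by standard (simp_all add: zero_list_def plus_list_def)
end

text \<open>
  A \<open>k\<close>-algebra generated over \<open>R\<close> by \<open>X\<close>, \<open>Y\<close>, \<open>Y\<^sub>1\<close> is a quotient of the free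
  \<open>k\<close>-algebra on these three letters and one letter \<open>Coef r\<close> for each \<open>r\<close> in \<open>R\<close>, in which
  \<open>r \<mapsto> Coef r\<close> becomes a homomorphism of \<open>k\<close>-algebras (first four families below).
\<close>

datatype 'r letter = Coef 'r | LX | LY | LY1

type_synonym 'k free = "'k coord letter list \<Rightarrow>\<^sub>0 'k"

abbreviation gen :: "'k coord letter \<Rightarrow> 'k::field free"
  where "gen l \<equiv> Poly_Mapping.single [l] 1"

abbreviation scal :: "'k::field \<Rightarrow> 'k free"
  where "scal c \<equiv> Poly_Mapping.single [] c"

definition relations :: "'k::field \<Rightarrow> 'k free set"
  where "relations q =
      {gen (Coef (r + s)) - (gen (Coef r) + gen (Coef s)) | r s. True}
    \<union> {gen (Coef (r * s)) - gen (Coef r) * gen (Coef s) | r s. True}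
    \<union> {gen (Coef (const c)) - scal c | c. True}
    \<union> {gen LY * gen LX - gen (Coef tau),
       gen LX * gen LY - gen (Coef (tau - 1)),
       gen LY1 * gen LX - gen (Coef (const q * sigma - 1)),
       gen LX * gen LY1 - gen (Coef (sigma - 1)),
       gen LY1 * gen (Coef (tau - 1)) - gen LY * gen (Coef (sigma - 1))}
    \<union> {gen LX * gen (Coef r) - gen (Coef (alpha q r)) * gen LX | r. True}
    \<union> {gen LY * gen (Coef r) - gen (Coef (inv_into UNIV (alpha q) r)) * gen LY | r. True}
    \<union> {gen LY1 * gen (Coef r) - gen (Coef (inv_into UNIV (alpha q) r)) * gen LY1 | r. True}"

abbreviation free_ring :: "'k::field free ring"
  where "free_ring \<equiv> ring_of_type_algebra"

definition D_ideal :: "'k::field \<Rightarrow> 'k free set"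
  where "D_ideal q = genideal free_ring (relations q)"

definition D_alg :: "'k::field \<Rightarrow> 'k free set ring"
  where "D_alg q = free_ring Quot D_ideal q"

lemma ring_of_type_algebra_simps:
  "carrier ring_of_type_algebra = UNIV" "monoid.mult ring_of_type_algebra = (*)"
  "one ring_of_type_algebra = 1" "ring.zero ring_of_type_algebra = 0"
  "add ring_of_type_algebra = (+)"
  by (simp_all add: ring_of_type_algebra_def fun_eq_iff)

lemma ring_ring_of_type_algebra: "ring (ring_of_type_algebra :: 'a::ring_1 ring)"
proof (rule ringI)
  show "abelian_group (ring_of_type_algebra :: 'a ring)"
  proof (rule abelian_groupI)
    fix x :: 'a
    show "\<exists>y\<in>carrier ring_of_type_algebra. y \<oplus>\<^bsub>ring_of_type_algebra\<^esub> x = \<zero>\<^bsub>ring_of_type_algebra\<^esub>"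
      by (rule bexI[of _ "- x"]) (simp_all add: ring_of_type_algebra_simps)
  qed (simp_all add: ring_of_type_algebra_simps add_ac)
  show "Group.monoid (ring_of_type_algebra :: 'a ring)"
    by (rule monoidI) (simp_all add: ring_of_type_algebra_simps mult.assoc)
qed (simp_all add: ring_of_type_algebra_simps algebra_simps)

lemma ideal_D_ideal: "ideal (D_ideal q) free_ring"
  unfolding D_ideal_def
  by (rule ring.genideal_ideal[OF ring_ring_of_type_algebra])
     (simp add: ring_of_type_algebra_simps)

lemma ring_D_alg: "ring (D_alg q)"
  unfolding D_alg_def by (rule ideal.quotient_is_ring[OF ideal_D_ideal])

definition D_gen :: "'k::field \<Rightarrow> 'k coord letter \<Rightarrow> 'k free set"
  where "D_gen q l = D_ideal q +>\<^bsub>free_ring\<^esub> gen l"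

definition D_coef :: "'k::field \<Rightarrow> 'k coord \<Rightarrow> 'k free set"
  where "D_coef q r = D_gen q (Coef r)"

definition A_q :: "'k::field \<Rightarrow> 'k free set ring"
  where "A_q q = (D_alg q)
    \<lparr>carrier := generate_ring (D_alg q) (range (D_coef q) \<union> {D_gen q LX, D_gen q LY1})\<rparr>"

definition A_1 :: "'k::field \<Rightarrow> 'k free set ring"
  where "A_1 q = (D_alg q)
    \<lparr>carrier := generate_ring (D_alg q) (range (D_coef q) \<union> {D_gen q LX, D_gen q LY})\<rparr>"


section \<open>Left modules over a not necessarily commutative ring\<close>

text \<open>
  The library's \<open>module\<close> locale asks for a commutative ring; its record type and its
  \<open>submodule\<close> locale do not depend on commutativity and are used here.
\<close>

locale left_module = R?: ring R + M?: abelian_group M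
  for R :: "('a, 'b) ring_scheme" (structure) and M :: "('a, 'c, 'd) module_scheme" (structure) +
  assumes smult_closed: "\<lbrakk>a \<in> carrier R; x \<in> carrier M\<rbrakk> \<Longrightarrow> a \<odot>\<^bsub>M\<^esub> x \<in> carrier M"
    and smult_l_distr: "\<lbrakk>a \<in> carrier R; b \<in> carrier R; x \<in> carrier M\<rbrakk> \<Longrightarrow>
      (a \<oplus> b) \<odot>\<^bsub>M\<^esub> x = a \<odot>\<^bsub>M\<^esub> x \<oplus>\<^bsub>M\<^esub> b \<odot>\<^bsub>M\<^esub> x"
    and smult_r_distr: "\<lbrakk>a \<in> carrier R; x \<in> carrier M; y \<in> carrier M\<rbrakk> \<Longrightarrow>
      a \<odot>\<^bsub>M\<^esub> (x \<oplus>\<^bsub>M\<^esub> y) = a \<odot>\<^bsub>M\<^esub> x \<oplus>\<^bsub>M\<^esub> a \<odot>\<^bsub>M\<^esub> y"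
    and smult_assoc: "\<lbrakk>a \<in> carrier R; b \<in> carrier R; x \<in> carrier M\<rbrakk> \<Longrightarrow>
      (a \<otimes> b) \<odot>\<^bsub>M\<^esub> x = a \<odot>\<^bsub>M\<^esub> (b \<odot>\<^bsub>M\<^esub> x)"
    and smult_one: "x \<in> carrier M \<Longrightarrow> \<one> \<odot>\<^bsub>M\<^esub> x = x"

definition irreducible_module ::
    "('a, 'b) ring_scheme \<Rightarrow> ('a, 'c, 'd) module_scheme \<Rightarrow> bool"
  where "irreducible_module A M \<longleftrightarrow> left_module A M \<and> carrier M \<noteq> {\<zero>\<^bsub>M\<^esub>} \<and>
    (\<forall>N. submodule N A M \<longrightarrow> N = {\<zero>\<^bsub>M\<^esub>} \<or> N = carrier M)"

definition indecomposable_module ::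
    "('a, 'b) ring_scheme \<Rightarrow> ('a, 'c, 'd) module_scheme \<Rightarrow> bool"
  where "indecomposable_module A M \<longleftrightarrow> left_module A M \<and> carrier M \<noteq> {\<zero>\<^bsub>M\<^esub>} \<and>
    (\<forall>N N'. submodule N A M \<and> submodule N' A M \<and>
        N <+>\<^bsub>M\<^esub> N' = carrier M \<and> N \<inter> N' = {\<zero>\<^bsub>M\<^esub>} \<longrightarrow>
      N = {\<zero>\<^bsub>M\<^esub>} \<or> N' = {\<zero>\<^bsub>M\<^esub>})"

definition weight_space ::
    "'k::field \<Rightarrow> ('k free set, 'm, 'd) module_scheme \<Rightarrow> 'k coord set \<Rightarrow> 'm set"
  where "weight_space q M \<mm> =
    {v \<in> carrier M. \<forall>r\<in>\<mm>. D_coef q r \<odot>\<^bsub>M\<^esub> v = \<zero>\<^bsub>M\<^esub>}"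

text \<open>The sum of the weight spaces is the additive subgroup generated by their union.\<close>

definition weight_module ::
    "'k::field \<Rightarrow> ('k free set, 'm, 'd) module_scheme \<Rightarrow> bool"
  where "weight_module q M \<longleftrightarrow> left_module (D_alg q) M \<and>
    carrier M = generate (add_monoid M)
      (\<Union>\<mm>\<in>{\<mm>. maximalideal \<mm> (ring_of_type_algebra :: 'k coord ring)}. weight_space q M \<mm>)"

end

theory Submission
  imports Defs
begin

text \<open>
  Suppose \<open>M = N \<oplus> N'\<close> with \<open>N\<close>, \<open>N'\<close> nonzero and stable under \<open>R\<close> and \<open>X\<close>. The projections
  respect weights, so there are nonzero weight vectors \<open>v \<in> N\<close>, \<open>v' \<in> N'\<close>, of weights \<open>I\<close>, \<open>I'\<close>.
  Since \<open>X\<close> cancels against \<open>Y\<close> and \<open>Y\<^sub>1\<close>, the degree \<open>i\<close> part of \<open>D\<close> is \<open>R X\<^sup>i\<close> for \<open>i \<ge> 0\<close>; it maps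
  \<open>v\<close> to weight \<open>\<alpha>\<^sup>i(I)\<close>. As \<open>\<alpha>\<close> acts freely on the maximal ideals, the weights \<open>\<alpha>\<^sup>i(I)\<close> are distinct,
  so \<open>v' \<in> Dv = M\<close> lies in a single \<open>D\<^sub>i v\<close>, and likewise \<open>v\<close> lies in \<open>D\<^sub>-\<^sub>i v'\<close>. If \<open>i \<ge> 0\<close> then
  \<open>v' \<in> R X\<^sup>i v \<subseteq> N\<close>, otherwise \<open>v \<in> N'\<close>, a contradiction in both cases.

  For freeness let \<open>\<beta> : \<tau> \<mapsto> \<tau> + c, \<sigma> \<mapsto> u \<sigma>\<close> stabilize a maximal ideal \<open>I\<close>. If \<open>u = 1\<close>, \<open>c \<noteq> 0\<close> in
  characteristic 0, an inverse \<open>p\<close> of \<open>\<tau> - 1\<close> modulo \<open>I\<close> gives the polynomial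
  \<open>(\<tau> - 1) p(\<tau>, \<sigma>) - 1\<close> in \<open>\<tau>\<close> over the \<open>\<beta>\<close>-fixed ring \<open>k[\<sigma>, \<sigma>\<inverse>]\<close>, with the infinitely many roots
  \<open>\<tau> + n c\<close> in \<open>R/I\<close>; so its coefficients vanish in \<open>R/I\<close>, although its value at 1 is \<open>-1\<close>. If \<open>u\<close> is
  not a root of unity, start from an inverse of \<open>\<sigma> - 1\<close>: the terms \<open>p\<^sub>j(\<tau>) \<sigma>\<^sup>j\<close> of an element of \<open>I\<close>
  lie in generalized eigenspaces of \<open>\<beta>\<close> for the distinct eigenvalues \<open>u\<^sup>j\<close>, hence again in \<open>I\<close>.
\<close>

section \<open>Freeness of the action on maximal ideals\<close>

text \<open>Maximality is stated as invertibility modulo \<open>I\<close>, so that computations in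
  the residue field run on representatives and no quotient is formed.\<close>

locale max_ideal =
  fixes I :: "'a::comm_ring_1 set"
  assumes zero_in: "0 \<in> I"
    and add_in: "\<lbrakk>x \<in> I; y \<in> I\<rbrakk> \<Longrightarrow> x + y \<in> I"
    and mult_in: "x \<in> I \<Longrightarrow> r * x \<in> I"
    and one_notin: "1 \<notin> I"
    and inverse_mod: "x \<notin> I \<Longrightarrow> \<exists>y. x * y - 1 \<in> I"
begin

lemma mult_in_right: "x \<in> I \<Longrightarrow> x * r \<in> I"
  using mult_in[of x r] by (simp add: mult.commute)

lemma diff_in: "\<lbrakk>x \<in> I; y \<in> I\<rbrakk> \<Longrightarrow> x - y \<in> I"
  using add_in[of x "(-1) * y"] mult_in[of y "-1"] by simp

lemma sum_in: "(\<And>j. j \<in> J \<Longrightarrow> f j \<in> I) \<Longrightarrow> sum f J \<in> I"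
  by (induction J rule: infinite_finite_induct) (auto intro: zero_in add_in)

lemma prime_mult:
  assumes "x * y \<in> I"
  shows "x \<in> I \<or> y \<in> I"
proof (rule disjCI)
  assume "y \<notin> I"
  then obtain z where z: "y * z - 1 \<in> I" using inverse_mod by blast
  have "(x * y) * z - x * (y * z - 1) \<in> I"
    by (intro diff_in mult_in z mult_in_right assms)
  then show "x \<in> I" by (simp add: algebra_simps)
qed

lemma unit_notin:
  assumes "x * y = 1"
  shows "x \<notin> I"
  using assms one_notin mult_in_right[of x y] by auto

lemma eq_if_subset:
  assumes "max_ideal J" "I \<subseteq> J"
  shows "I = J"
proof (rule ccontr)
  assume "I \<noteq> J"
  then obtain x where x: "x \<in> J" "x \<notin> I" using assms(2) by blast
  then obtain y where "x * y - 1 \<in> I" using inverse_mod by blast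
  then have "x * y - (x * y - 1) \<in> J"
    using max_ideal.diff_in[OF assms(1) max_ideal.mult_in_right[OF assms(1) x(1), of y]] assms(2)
    by blast
  then show False using max_ideal.one_notin[OF assms(1)] by simp
qed

lemma poly_in:
  assumes "\<And>i. coeff P i \<in> I"
  shows "poly P x \<in> I"
  unfolding poly_altdef by (intro sum_in mult_in_right assms)

text \<open>Splitting off \<open>[:- c, 1:]\<close> for one root \<open>c\<close> lowers the degree,
  and the quotient still vanishes modulo the prime \<open>I\<close> on the rest of \<open>S\<close>,
  whose elements are incongruent to \<open>c\<close>. This is the usual count of roots over the
  residue field.\<close>

lemma coeff_in_if_infinitely_many_roots:
  assumes "infinite S" "\<And>x y. \<lbrakk>x \<in> S; y \<in> S; x - y \<in> I\<rbrakk> \<Longrightarrow> x = y"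
    and "\<And>x. x \<in> S \<Longrightarrow> poly P x \<in> I"
  shows "coeff P i \<in> I"
  using assms
proof (induction "degree P" arbitrary: P S i)
  case 0
  then obtain a where P: "P = [:a:]" by (metis degree_eq_zeroE)
  obtain x where "x \<in> S" using 0(2) by fastforce
  with 0(4) have "a \<in> I" unfolding P by fastforce
  then show ?case unfolding P by (cases i) (auto simp: zero_in)
next
  case (Suc n)
  obtain c where c: "c \<in> S" using Suc(3) by fastforce
  define Q where "Q = synthetic_div P c"
  have P: "P = [:- c, 1:] * Q + [:poly P c:]"
    unfolding Q_def by (simp only: synthetic_div_correct')
  have Q: "coeff Q j \<in> I" for j
  proof (rule Suc(1)[of Q "S - {c}"])
    show "n = degree Q" using Suc(2) by (simp add: Q_def degree_synthetic_div)
    show "infinite (S - {c})" using Suc(3) by simp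
    fix x assume x: "x \<in> S - {c}"
    have "poly P x - poly P c \<in> I" using Suc(5) x c by (intro diff_in) auto
    moreover have "poly P x = (x - c) * poly Q x + poly P c"
      by (subst P) (simp add: algebra_simps)
    ultimately have "(x - c) * poly Q x \<in> I" by simp
    moreover have "x - c \<notin> I" using Suc(4) x c by blast
    ultimately show "poly Q x \<in> I" using prime_mult by blast
  qed (use Suc(4) in blast)
  have "coeff ([:- c, 1:] * Q) i + coeff [:poly P c:] i \<in> I"
    using Q Suc(5)[OF c] zero_in diff_in[OF zero_in mult_in[OF Q]]
    by (intro add_in) (auto simp: coeff_pCons intro!: diff_in mult_in split: nat.split)
  then show ?case by (metis P coeff_add)
qed

end

lemma max_ideal_if_maximalideal:
  assumes "maximalideal I (ring_of_type_algebra :: 'a::comm_ring_1 ring)"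
  shows "max_ideal I"
proof -
  interpret R: ring "ring_of_type_algebra :: 'a ring" by (rule ring_ring_of_type_algebra)
  interpret maximalideal I "ring_of_type_algebra :: 'a ring" by fact
  note simps = ring_of_type_algebra_simps
  have add: "x + y \<in> I" if "x \<in> I" "y \<in> I" for x y
    using a_closed[OF that] by (simp add: simps)
  have mult: "r * x \<in> I" if "x \<in> I" for x r
    using I_l_closed[OF that, of r] by (simp add: simps)
  have zero: "0 \<in> I"
    using additive_subgroup.zero_closed[OF additive_subgroup_axioms] by (simp add: simps)
  show ?thesis
  proof
    show one: "1 \<notin> I"
    proof
      assume "1 \<in> I"
      then have "x \<in> I" for x using mult[of 1 x] by simp
      then show False using I_notcarr by (auto simp: simps)
    qed
    fix x assume x: "x \<notin> I"
    \<comment> \<open>The ideal generated by \<open>x\<close> and \<open>I\<close>; maximality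
      forces it to be the whole ring, hence to contain 1.\<close>
    define J where "J = {x * y + z | y z. z \<in> I}"
    have J: "x * y + z \<in> J" if "z \<in> I" for y z using that by (auto simp: J_def)
    have "ideal J (ring_of_type_algebra :: 'a ring)"
    proof (rule idealI)
      show "ring (ring_of_type_algebra :: 'a ring)" by (rule ring_ring_of_type_algebra)
      show "subgroup J (add_monoid (ring_of_type_algebra :: 'a ring))"
      proof (rule R.add.subgroupI)
        show "J \<noteq> {}" using J[OF zero] by blast
        fix a assume "a \<in> J"
        then obtain y z where a: "a = x * y + z" "z \<in> I" by (auto simp: J_def)
        have "\<ominus>\<^bsub>ring_of_type_algebra :: 'a ring\<^esub> a = - a"
          using R.minus_equality[of "- a" a] by (simp add: simps)
        moreover have "- a = x * (- y) + (-1) * z" by (simp add: a)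
        ultimately show "\<ominus>\<^bsub>ring_of_type_algebra :: 'a ring\<^esub> a \<in> J"
          using J[OF mult[OF a(2)]] by metis
        fix b assume "b \<in> J"
        then obtain y' z' where b: "b = x * y' + z'" "z' \<in> I" by (auto simp: J_def)
        have "a + b = x * (y + y') + (z + z')" by (simp add: a b algebra_simps)
        then show "a \<oplus>\<^bsub>ring_of_type_algebra :: 'a ring\<^esub> b \<in> J"
          using J[OF add[OF a(2) b(2)]] by (simp add: simps)
      qed (simp add: simps)
      fix a r assume "a \<in> J"
      then obtain y z where a: "a = x * y + z" "z \<in> I" by (auto simp: J_def)
      have "r * a = x * (r * y) + r * z" by (simp add: a algebra_simps)
      then have "r * a \<in> J" using J[OF mult[OF a(2)]] by metis
      then show "monoid.mult ring_of_type_algebra r a \<in> J"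
        and "monoid.mult ring_of_type_algebra a r \<in> J"
        by (simp_all add: simps mult.commute)
    qed
    moreover have "I \<subseteq> J" using J[of _ 0] by auto
    moreover have "J \<noteq> I" using J[OF zero, of 1] x by auto
    ultimately have "J = UNIV" using I_maximal by (auto simp: simps)
    then obtain y z where "1 = x * y + z" "z \<in> I" unfolding J_def using UNIV_I[of 1] by blast
    then have "x * y - 1 = (-1) * z" by (simp add: algebra_simps)
    then show "\<exists>y. x * y - 1 \<in> I" using mult[OF \<open>z \<in> I\<close>] by metis
  qed (fact zero add mult)+
qed

lemma inj_of_nat_if_CHAR_0:
  assumes "CHAR('a::comm_ring_1) = 0"
  shows "inj (of_nat :: nat \<Rightarrow> 'a)"
proof (rule linorder_injI)
  fix m n :: nat assume "m < n"
  then have "of_nat (n - m) \<noteq> (0 :: 'a)"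
    using assms unfolding CHAR_eq0_iff by (metis zero_less_diff)
  moreover have "(of_nat n :: 'a) = of_nat m + of_nat (n - m)"
    using \<open>m < n\<close> by (simp flip: of_nat_add)
  ultimately show "of_nat m \<noteq> (of_nat n :: 'a)" by simp
qed

section \<open>Translations of \<tau> modulo a maximal ideal\<close>

lemma const_diff: "const (a - b) = const a - const b"
  using const_add[of a "- b"] by (simp add: const_minus)

lemma const_power: "const (a ^ n) = const a ^ n"
  by (induction n) (simp_all add: const_mult)

lemma of_nat_coord: "(of_nat n :: 'k::field coord) = const (of_nat n)"
  by (induction n) (simp_all add: const_add)

lemma affine_subst_0 [simp]: "affine_subst c u 0 = 0"
  by (simp add: affine_subst_def)

lemma affine_subst_minus: "affine_subst c u (- p) = - affine_subst c u p"
  using affine_subst_add[of c u p "- p"] by (simp add: eq_neg_iff_add_eq_0 add.commute)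

lemma affine_subst_diff: "affine_subst c u (p - p') = affine_subst c u p - affine_subst c u p'"
  using affine_subst_add[of c u p "- p'"] by (simp add: affine_subst_minus)

lemma affine_subst_sum: "affine_subst c u (sum f A) = (\<Sum>x\<in>A. affine_subst c u (f x))"
  by (induction A rule: infinite_finite_induct) (simp_all add: affine_subst_add)

lemma affine_subst_power: "u \<noteq> 0 \<Longrightarrow> affine_subst c u (p ^ n) = affine_subst c u p ^ n"
  by (induction n) (simp_all add: affine_subst_mult)

locale max_ideal_coord = max_ideal I for I :: "'k::field coord set"
begin

lemma const_notin: "a \<noteq> 0 \<Longrightarrow> const a \<notin> I"
  by (rule unit_notin[of _ "const (inverse a)"]) (simp flip: const_mult)

lemma sigma_notin: "sigma \<notin> I"
  by (rule unit_notin[OF sigma_inv])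

lemma sigma_power_notin: "sigma ^ n \<notin> I"
  by (induction n) (use one_notin sigma_notin prime_mult in auto)

lemma not_translation_invariant:
  assumes "CHAR('k) = 0" "c \<noteq> 0" and I: "\<And>r. r \<in> I \<Longrightarrow> affine_subst c 1 r \<in> I"
  shows False
proof -
  have I': "affine_subst (of_nat n * c) 1 r \<in> I" if "r \<in> I" for n r
  proof (induction n)
    case (Suc n)
    have "affine_subst (of_nat (Suc n) * c) 1 r
        = affine_subst c 1 (affine_subst (of_nat n * c) 1 r)"
      by (simp add: affine_subst_affine_subst algebra_simps)
    then show ?case using I[OF Suc] by simp
  qed (use that in \<open>simp add: affine_subst_id\<close>)
  have "tau - 1 \<notin> I"
  proof
    assume "tau - 1 \<in> I"
    \<comment> \<open>This difference is the unit \<open>const c\<close>.\<close>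
    then have "affine_subst c 1 (tau - 1) - (tau - 1) \<in> I" using diff_in I by blast
    then show False using const_notin[OF assms(2)] by (simp add: affine_subst_diff)
  qed
  then obtain p where p: "(tau - 1) * p - 1 \<in> I" using inverse_mod by blast
  \<comment> \<open>Here \<open>p\<close> is written in powers of \<tau>; the coefficients involve
    only \<sigma>, so every translation fixes them.\<close>
  obtain P where fixed: "\<And>d i. affine_subst d 1 (coeff P i) = coeff P i" and P: "p = poly P tau"
  proof -
    have "\<exists>P. (\<forall>d i. affine_subst d 1 (coeff P i) = coeff P i) \<and> p = poly P tau"
    proof (induction p rule: coord_induct)
      case (monom i j a)
      have "Poly_Mapping.single (i, j) a = poly (Polynomial.monom (Poly_Mapping.single (0, j) a) i) tau"
        by (simp add: poly_monom tau_power mult_single)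
      moreover have "affine_subst d 1 (coeff (Polynomial.monom (Poly_Mapping.single (0, j) a) i) l)
          = coeff (Polynomial.monom (Poly_Mapping.single (0, j) a) i) l" for d :: 'k and l
        by (simp add: affine_subst_single)
      ultimately show ?case by blast
    next
      case (add p p')
      then obtain P P' where *: "\<forall>d i. affine_subst d 1 (coeff P i) = coeff P i" "p = poly P tau"
        "\<forall>d i. affine_subst d 1 (coeff P' i) = coeff P' i" "p' = poly P' tau" by blast
      show ?case by (rule exI[of _ "P + P'"]) (use * in \<open>simp add: affine_subst_add\<close>)
    qed
    then show ?thesis using that by blast
  qed
  \<comment> \<open>Its value at \<open>tau\<close> is \<open>(tau - 1) * p - 1\<close>, which lies
    in \<open>I\<close>, while its value at 1 is \<open>- 1\<close>.\<close>
  define Q where "Q = [:- 1, 1:] * P - 1"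
  have Qfixed: "affine_subst d 1 (coeff Q i) = coeff Q i" for d i
    by (cases i) (simp_all add: Q_def coeff_pCons fixed affine_subst_diff affine_subst_minus)
  define x :: "nat \<Rightarrow> 'k coord" where "x n = tau + const (of_nat n * c)" for n
  have inj: "m = n" if "x m - x n \<in> I" for m n
  proof (rule ccontr)
    assume "m \<noteq> n"
    then have "(of_nat m - of_nat n :: 'k) * c \<noteq> 0"
      using assms(1,2) inj_of_nat_if_CHAR_0 by (auto dest: injD)
    moreover have "x m - x n = const ((of_nat m - of_nat n) * c)"
      by (simp add: x_def const_diff left_diff_distrib)
    ultimately show False using that const_notin by metis
  qed
  have "coeff Q i \<in> I" for i
  proof (rule coeff_in_if_infinitely_many_roots[of "range x"])
    have "inj x" by (rule injI) (metis inj diff_self zero_in)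
    then show "infinite (range x)" using finite_imageD infinite_UNIV_nat by blast
    fix y assume "y \<in> range x"
    then obtain n where n: "y = x n" by blast
    \<comment> \<open>With fixed coefficients the translation only moves the argument, so each
      translate of \<tau> is again a root modulo \<open>I\<close>.\<close>
    have "affine_subst (of_nat n * c) 1 (poly Q tau) = poly Q (x n)"
      by (simp add: poly_altdef affine_subst_sum affine_subst_mult affine_subst_power x_def Qfixed)
    then show "poly Q y \<in> I"
      using I'[OF p, of n] by (simp add: n Q_def P left_diff_distrib)
  qed (use inj in blast)
  then have "poly Q 1 \<in> I" by (rule poly_in)
  then have "0 - poly Q 1 \<in> I" using diff_in zero_in by blast
  then show False using one_notin by (simp add: Q_def)
qed

end

section \<open>Generalized eigenspaces of a substitution \<beta>, through the operators
  \<open>\<beta> - l\<close>\<close>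

definition subst_eigen :: "'k::field \<Rightarrow> 'k \<Rightarrow> 'k \<Rightarrow> 'k coord \<Rightarrow> 'k coord"
  where "subst_eigen c u l p = affine_subst c u p - const l * p"

lemma subst_eigen_add: "subst_eigen c u l (p + p') = subst_eigen c u l p + subst_eigen c u l p'"
  by (simp add: subst_eigen_def affine_subst_add algebra_simps)

lemma subst_eigen_const_mult:
  "u \<noteq> 0 \<Longrightarrow> subst_eigen c u l (const a * p) = const a * subst_eigen c u l p"
  by (simp add: subst_eigen_def affine_subst_mult algebra_simps)

lemma subst_eigen_0: "subst_eigen c u l 0 = 0"
  by (simp add: subst_eigen_def)

lemma subst_eigen_commute:
  "u \<noteq> 0 \<Longrightarrow> subst_eigen c u l (subst_eigen c u l' p) = subst_eigen c u l' (subst_eigen c u l p)"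
  by (simp add: subst_eigen_def affine_subst_diff affine_subst_mult algebra_simps)

lemma funpow_subst_eigen_commute:
  "u \<noteq> 0 \<Longrightarrow> (subst_eigen c u l ^^ n) (subst_eigen c u l' p)
    = subst_eigen c u l' ((subst_eigen c u l ^^ n) p)"
  by (induction n) (simp_all add: subst_eigen_commute)

lemma funpow_subst_eigen_commute':
  "u \<noteq> 0 \<Longrightarrow> (subst_eigen c u l ^^ n) ((subst_eigen c u l' ^^ m) p)
    = (subst_eigen c u l' ^^ m) ((subst_eigen c u l ^^ n) p)"
  by (induction m) (simp_all add: funpow_subst_eigen_commute)

lemma funpow_subst_eigen_add:
  "(subst_eigen c u l ^^ n) (p + p') = (subst_eigen c u l ^^ n) p + (subst_eigen c u l ^^ n) p'"
  by (induction n) (simp_all add: subst_eigen_add)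

lemma funpow_subst_eigen_0: "(subst_eigen c u l ^^ n) 0 = 0"
  by (induction n) (simp_all add: subst_eigen_0)

lemma funpow_subst_eigen_sum:
  "(subst_eigen c u l ^^ n) (sum f A) = (\<Sum>x\<in>A. (subst_eigen c u l ^^ n) (f x))"
  by (induction A rule: infinite_finite_induct)
     (simp_all add: funpow_subst_eigen_add funpow_subst_eigen_0)

lemma funpow_subst_eigen_const_mult:
  "u \<noteq> 0 \<Longrightarrow> (subst_eigen c u l ^^ n) (const a * p) = const a * (subst_eigen c u l ^^ n) p"
  by (induction n) (simp_all add: subst_eigen_const_mult)

text \<open>Since \<open>sigma ^ j\<close> is an eigenvector for \<open>u ^ j\<close>,
  multiplication by it carries the generalized eigenspace for 1 into the one for
  \<open>u ^ j\<close>.\<close>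

lemma funpow_subst_eigen_sigma_power:
  assumes "u \<noteq> 0"
  shows "(subst_eigen c u (u ^ j) ^^ n) (p * sigma ^ j)
    = const (u ^ (j * n)) * sigma ^ j * (subst_eigen c u 1 ^^ n) p"
proof (induction n)
  case (Suc n)
  have "subst_eigen c u (u ^ j) (sigma ^ j * r) = const (u ^ j) * (sigma ^ j * subst_eigen c u 1 r)" for r
    using assms
    by (simp add: subst_eigen_def affine_subst_mult affine_subst_power power_mult_distrib const_power
        algebra_simps)
  then show ?case
    by (simp add: Suc subst_eigen_const_mult assms mult.assoc power_add const_mult)
qed simp

text \<open>The generalized eigenspace for the eigenvalue 1; the exponent \<open>n\<close> may vary
  with \<open>p\<close>, as it does for powers of \<tau>.\<close>

definition unipotent_part :: "'k::field \<Rightarrow> 'k \<Rightarrow> 'k coord set"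
  where "unipotent_part c u = {p. \<exists>n. (subst_eigen c u 1 ^^ n) p = 0}"

lemma unipotent_part_add:
  assumes "p \<in> unipotent_part c u" "p' \<in> unipotent_part c u"
  shows "p + p' \<in> unipotent_part c u"
proof -
  obtain m n where "(subst_eigen c u 1 ^^ m) p = 0" "(subst_eigen c u 1 ^^ n) p' = 0"
    using assms by (auto simp: unipotent_part_def)
  then have "(subst_eigen c u 1 ^^ (n + m)) p = 0" "(subst_eigen c u 1 ^^ (m + n)) p' = 0"
    by (simp_all only: funpow_add o_apply funpow_subst_eigen_0)
  then have "(subst_eigen c u 1 ^^ (m + n)) (p + p') = 0"
    by (simp add: funpow_subst_eigen_add add.commute)
  then show ?thesis by (auto simp: unipotent_part_def)
qed

lemma unipotent_part_const_mult:
  "u \<noteq> 0 \<Longrightarrow> p \<in> unipotent_part c u \<Longrightarrow> const a * p \<in> unipotent_part c u"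
  unfolding unipotent_part_def mem_Collect_eq
  by (metis funpow_subst_eigen_const_mult mult_zero_right)

lemma unipotent_part_0: "0 \<in> unipotent_part c u"
  by (auto simp: unipotent_part_def intro: funpow_subst_eigen_0)

lemma unipotent_part_sum:
  "(\<And>x. x \<in> A \<Longrightarrow> f x \<in> unipotent_part c u) \<Longrightarrow> sum f A \<in> unipotent_part c u"
  by (induction A rule: infinite_finite_induct) (auto intro: unipotent_part_0 unipotent_part_add)

lemma unipotent_part_diff:
  assumes "u \<noteq> 0" "p \<in> unipotent_part c u" "p' \<in> unipotent_part c u"
  shows "p - p' \<in> unipotent_part c u"
  using unipotent_part_add[OF assms(2) unipotent_part_const_mult[OF assms(1,3), of "-1"]]
  by (simp add: const_minus)

lemma unipotent_part_if_subst_eigen: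
  assumes "subst_eigen c u 1 p \<in> unipotent_part c u"
  shows "p \<in> unipotent_part c u"
proof -
  obtain n where "(subst_eigen c u 1 ^^ n) (subst_eigen c u 1 p) = 0"
    using assms by (auto simp: unipotent_part_def)
  then have "(subst_eigen c u 1 ^^ Suc n) p = 0" by (simp add: funpow_swap1)
  then show ?thesis unfolding unipotent_part_def by blast
qed

text \<open>Subtracting \<open>tau ^ i\<close> cancels the top term of the binomial expansion, so
  \<open>subst_eigen c u 1\<close> lowers the degree in \<tau> and induction on \<open>i\<close>
  applies.\<close>

lemma unipotent_part_tau_power:
  assumes "u \<noteq> 0"
  shows "tau ^ i \<in> unipotent_part c u"
proof (induction i rule: less_induct)
  case (less i)
  have "subst_eigen c u 1 (tau ^ i) = (tau + const c) ^ i - tau ^ i"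
    by (simp add: subst_eigen_def affine_subst_power assms)
  also have "\<dots> = (\<Sum>k<i. of_nat (i choose k) * tau ^ k * const c ^ (i - k))"
    by (simp add: binomial_ring lessThan_Suc_atMost[symmetric])
  also have "\<dots> = (\<Sum>k<i. const (of_nat (i choose k) * c ^ (i - k)) * tau ^ k)"
    by (simp add: of_nat_coord const_mult const_power mult_ac)
  also have "\<dots> \<in> unipotent_part c u"
    using less by (intro unipotent_part_sum unipotent_part_const_mult assms) auto
  finally show ?case by (rule unipotent_part_if_subst_eigen)
qed

context max_ideal_coord
begin

text \<open>This is coprimality of \<open>(x - l)\<^sup>m\<close> and \<open>(x - l')\<^sup>n\<close>, with the Bezout identity replaced by induction.\<close>

lemma generalized_eigenspaces_separate:
  assumes "u \<noteq> 0" "l \<noteq> l'" and I: "\<And>r. r \<in> I \<Longrightarrow> affine_subst c u r \<in> I"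
    and "(subst_eigen c u l ^^ m) p \<in> I" "(subst_eigen c u l' ^^ n) p \<in> I"
  shows "p \<in> I"
  using assms(4,5)
proof (induction "m + n" arbitrary: m n p rule: less_induct)
  case less
  have T: "subst_eigen c u a r \<in> I" if "r \<in> I" for a r
    unfolding subst_eigen_def by (intro diff_in mult_in I that)
  show ?case
  proof (cases "m = 0 \<or> n = 0")
    case False
    then obtain m' n' where mn: "m = Suc m'" "n = Suc n'" by (metis not0_implies_Suc)
    have "subst_eigen c u l p \<in> I"
    proof (rule less(1)[of m' n])
      show "(subst_eigen c u l ^^ m') (subst_eigen c u l p) \<in> I"
        using less(2) by (simp add: mn funpow_swap1)
      show "(subst_eigen c u l' ^^ n) (subst_eigen c u l p) \<in> I"
        by (subst funpow_subst_eigen_commute[OF assms(1)]) (rule T[OF less(3)])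
    qed (simp add: mn)
    moreover have "subst_eigen c u l' p \<in> I"
    proof (rule less(1)[of m n'])
      show "(subst_eigen c u l' ^^ n') (subst_eigen c u l' p) \<in> I"
        using less(3) by (simp add: mn funpow_swap1)
      show "(subst_eigen c u l ^^ m) (subst_eigen c u l' p) \<in> I"
        by (subst funpow_subst_eigen_commute[OF assms(1)]) (rule T[OF less(2)])
    qed (simp add: mn)
    \<comment> \<open>The two images differ by a nonzero constant multiple of
      \<open>p\<close>.\<close>
    ultimately have "subst_eigen c u l' p - subst_eigen c u l p \<in> I" by (intro diff_in)
    then have "const (l - l') * p \<in> I"
      by (simp add: subst_eigen_def const_diff left_diff_distrib)
    then show ?thesis using prime_mult[of "const (l - l')" p] const_notin[of "l - l'"] assms(2) by simp
  qed (use less(2,3) in auto)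
qed

text \<open>A power of \<open>subst_eigen c u (l i)\<close> that kills \<open>w i\<close> removes
  this summand, and by induction it maps every other \<open>w j\<close> into \<open>I\<close>. As
  \<open>w j\<close> is also killed by a power for the eigenvalue \<open>l j\<close>, separation
  puts \<open>w j\<close> itself into \<open>I\<close>.\<close>

lemma generalized_eigen_components_in:
  assumes "finite J" "inj_on l J" "u \<noteq> 0" and I: "\<And>r. r \<in> I \<Longrightarrow> affine_subst c u r \<in> I"
    and "\<And>j. j \<in> J \<Longrightarrow> \<exists>n. (subst_eigen c u (l j) ^^ n) (w j) = 0"
    and "sum w J \<in> I" "j \<in> J"
  shows "w j \<in> I"
  using assms(1,2,5,6,7)
proof (induction J arbitrary: w j rule: finite_induct)
  case (insert i J)
  obtain n where n: "(subst_eigen c u (l i) ^^ n) (w i) = 0" using insert.prems by blast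
  have T: "(subst_eigen c u a ^^ n) r \<in> I" if "r \<in> I" for a n r
    by (induction n) (auto simp: subst_eigen_def intro!: that diff_in mult_in I)
  have "(subst_eigen c u (l i) ^^ n) (w i + sum w J) \<in> I"
    using insert by (intro T) simp
  then have sum: "(\<Sum>j\<in>J. (subst_eigen c u (l i) ^^ n) (w j)) \<in> I"
    by (simp add: funpow_subst_eigen_add n funpow_subst_eigen_sum)
  have *: "w j \<in> I" if j: "j \<in> J" for j
  proof -
    obtain m where m: "(subst_eigen c u (l j) ^^ m) (w j) = 0" using insert.prems j by blast
    have "(subst_eigen c u (l i) ^^ n) (w j) \<in> I"
    proof (rule insert.IH[of "\<lambda>j. (subst_eigen c u (l i) ^^ n) (w j)"])
      show "inj_on l J" using insert.prems by simp
      fix k assume "k \<in> J"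
      then obtain m where "(subst_eigen c u (l k) ^^ m) (w k) = 0" using insert.prems by blast
      then show "\<exists>m. (subst_eigen c u (l k) ^^ m) ((subst_eigen c u (l i) ^^ n) (w k)) = 0"
        by (intro exI[of _ m], subst funpow_subst_eigen_commute'[OF assms(3)])
           (simp add: funpow_subst_eigen_0)
    qed (fact sum j)+
    moreover have "l i \<noteq> l j" using insert.prems(1) insert.hyps(2) j by auto
    moreover have "(subst_eigen c u (l j) ^^ m) (w j) \<in> I" using m zero_in by simp
    ultimately show ?thesis by (metis generalized_eigenspaces_separate assms(3) I)
  qed
  have "(w i + sum w J) - sum w J \<in> I"
    using insert * by (intro diff_in sum_in) auto
  then have "w i \<in> I" by simp
  then show ?case using * insert.prems(4) by blast
qed simp

lemma not_dilation_invariant: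
  assumes "u \<noteq> 0" "\<And>n. n > 0 \<Longrightarrow> u ^ n \<noteq> 1" and I: "\<And>r. r \<in> I \<Longrightarrow> affine_subst c u r \<in> I"
  shows False
proof -
  let ?C = "unipotent_part c u"
  have "sigma - 1 \<notin> I"
  proof
    assume *: "sigma - 1 \<in> I"
    then have "affine_subst c u (sigma - 1) - const u * (sigma - 1) \<in> I"
      using diff_in I mult_in by blast
    moreover have "affine_subst c u (sigma - 1) - const u * (sigma - 1) = const (u - 1)"
      by (simp add: affine_subst_diff const_diff algebra_simps)
    ultimately show False using const_notin[of "u - 1"] assms(2)[of 1] by simp
  qed
  then obtain p where p: "(sigma - 1) * p - 1 \<in> I" using inverse_mod by blast
  \<comment> \<open>The factor \<open>sigma ^ N\<close> clears negative exponents, which makes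
    \<open>p\<close> a polynomial in \<sigma>; its coefficients are polynomials in \<tau>, hence
    unipotent.\<close>
  obtain N P where CP: "\<And>i. coeff P i \<in> ?C" and P: "sigma ^ N * p = poly P sigma"
  proof -
    have "\<exists>N P. (\<forall>i. coeff P i \<in> ?C) \<and> sigma ^ N * p = poly P sigma"
    proof (induction p rule: coord_induct)
      case (monom i j a)
      have "sigma ^ nat (- j) * Poly_Mapping.single (i, j) a
          = poly (Polynomial.monom (const a * tau ^ i) (nat j)) sigma"
        by (simp add: poly_monom tau_power sigma_power const_def mult_single)
      moreover have "coeff (Polynomial.monom (const a * tau ^ i) (nat j)) k \<in> ?C" for k
        by (simp add: unipotent_part_0 unipotent_part_const_mult unipotent_part_tau_power assms)
      ultimately show ?case by blast
    next
      case (add p p')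
      then obtain N P N' P' where *: "\<forall>i. coeff P i \<in> ?C" "sigma ^ N * p = poly P sigma"
        "\<forall>i. coeff P' i \<in> ?C" "sigma ^ N' * p' = poly P' sigma" by blast
      have "sigma ^ (N + N') * (p + p') = sigma ^ N' * (sigma ^ N * p) + sigma ^ N * (sigma ^ N' * p')"
        by (simp add: power_add algebra_simps)
      also have "\<dots> = poly (Polynomial.monom 1 N' * P + Polynomial.monom 1 N * P') sigma"
        by (simp add: * poly_monom)
      finally show ?case
        using * by (intro exI[of _ "N + N'"] exI[of _ "Polynomial.monom 1 N' * P + Polynomial.monom 1 N * P'"])
          (auto simp: coeff_monom_mult unipotent_part_0 intro!: unipotent_part_add)
    qed
    then show ?thesis using that by blast
  qed
  \<comment> \<open>The term \<open>monom 1 N\<close> is the 1 of \<open>(sigma - 1) * p - 1\<close>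
    after multiplication by \<open>sigma ^ N\<close>; the value at 1 is again
    \<open>- 1\<close>.\<close>
  define Q where "Q = [:- 1, 1:] * P - Polynomial.monom 1 N"
  have one: "1 \<in> ?C" using unipotent_part_tau_power[OF assms(1), of 0 c] by simp
  have CQ: "coeff Q i \<in> ?C" for i
  proof -
    have "coeff Q i = (case i of 0 \<Rightarrow> 0 | Suc k \<Rightarrow> coeff P k) - coeff P i - (if N = i then 1 else 0)"
      by (simp add: Q_def coeff_pCons split: nat.split)
    also have "\<dots> \<in> ?C"
      using CP one unipotent_part_0
      by (intro unipotent_part_diff assms(1)) (auto split: nat.split)
    finally show ?thesis .
  qed
  have "poly Q sigma = (sigma - 1) * (sigma ^ N * p) - sigma ^ N"
    by (simp add: Q_def P poly_monom left_diff_distrib)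
  also have "\<dots> = sigma ^ N * ((sigma - 1) * p - 1)" by (simp add: algebra_simps)
  also have "\<dots> \<in> I" by (intro mult_in p)
  finally have sum: "(\<Sum>j\<le>degree Q. coeff Q j * sigma ^ j) \<in> I" by (simp add: poly_altdef)
  have "coeff Q j \<in> I" for j
  proof (cases "j \<le> degree Q")
    case True
    have "coeff Q j * sigma ^ j \<in> I"
    proof (rule generalized_eigen_components_in[where l = "\<lambda>j. u ^ j" and J = "{..degree Q}"])
      show "inj_on (\<lambda>j. u ^ j) {..degree Q}"
      proof (rule linorder_inj_onI)
        fix m n :: nat assume "m < n"
        then have "u ^ n = u ^ m * u ^ (n - m)" by (simp flip: power_add)
        then show "u ^ m \<noteq> u ^ n" using assms(1) assms(2)[of "n - m"] \<open>m < n\<close> by auto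
      qed auto
      fix j
      obtain n where "(subst_eigen c u 1 ^^ n) (coeff Q j) = 0"
        using CQ[of j] by (auto simp: unipotent_part_def)
      then show "\<exists>n. (subst_eigen c u (u ^ j) ^^ n) (coeff Q j * sigma ^ j) = 0"
        by (intro exI[of _ n]) (simp add: funpow_subst_eigen_sigma_power assms)
    qed (use assms(1) sum True in \<open>simp_all add: I\<close>)
    then show ?thesis using prime_mult sigma_power_notin by blast
  qed (simp add: coeff_eq_0 zero_in)
  then have "poly Q 1 \<in> I" by (rule poly_in)
  then have "0 - poly Q 1 \<in> I" using diff_in zero_in by blast
  then show False using one_notin by (simp add: Q_def poly_monom)
qed

end

section \<open>Integer powers of \<alpha> and the freeness of their action\<close>

definition alpha_pow :: "'k::field \<Rightarrow> int \<Rightarrow> 'k coord \<Rightarrow> 'k coord"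
  where "alpha_pow q i = affine_subst (- of_int i) (inverse q powi i)"

lemma alpha_pow_0: "alpha_pow q 0 r = r"
  by (simp add: alpha_pow_def affine_subst_id)

lemma alpha_pow_1: "alpha_pow q 1 = alpha q"
  by (simp add: alpha_pow_def alpha_def)

lemma alpha_pow_minus_1: "q \<noteq> 0 \<Longrightarrow> alpha_pow q (-1) = inv_into UNIV (alpha q)"
  by (simp add: alpha_pow_def inv_alpha power_int_minus)

lemma alpha_pow_alpha_pow: "q \<noteq> 0 \<Longrightarrow> alpha_pow q i (alpha_pow q j r) = alpha_pow q (i + j) r"
  by (simp add: alpha_pow_def affine_subst_affine_subst power_int_add)

text \<open>Stability passes from \<open>n\<close> to all its multiples. If \<open>q\<close> is not
  a root of unity, the power |n| of \<alpha> scales \<sigma> by an element of infinite order. If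
  \<open>q ^ k = 1\<close>, the power k|n| is a pure translation, nontrivial in characteristic
  0.\<close>

lemma (in max_ideal_coord) alpha_pow_free:
  assumes "q \<noteq> 0" "CHAR('k) = 0 \<or> (\<forall>n>0. q ^ n \<noteq> 1)" "n \<noteq> 0"
    and I: "\<And>r. alpha_pow q n r \<in> I \<longleftrightarrow> r \<in> I"
  shows False
proof -
  have "alpha_pow q (int k * n) r \<in> I \<longleftrightarrow> r \<in> I" for k r
  proof (induction k)
    case (Suc k)
    have "alpha_pow q (int (Suc k) * n) r = alpha_pow q n (alpha_pow q (int k * n) r)"
      by (simp add: alpha_pow_alpha_pow assms(1) algebra_simps)
    then show ?case by (simp add: I Suc)
  qed (simp add: alpha_pow_0)
  note pos = this
  \<comment> \<open>The hypothesis is an equivalence, so stability also holds for the inverse and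
    the sign of \<open>n\<close> is harmless.\<close>
  have neg: "alpha_pow q (- (int k * n)) r \<in> I \<longleftrightarrow> r \<in> I" for k r
    using pos[of k "alpha_pow q (- (int k * n)) r"]
    by (simp add: alpha_pow_alpha_pow assms(1) alpha_pow_0)
  define m where "m = nat \<bar>n\<bar>"
  have m: "m > 0" using assms(3) by (simp add: m_def)
  have mk: "alpha_pow q (int (k * m)) r \<in> I" if "r \<in> I" for k r
    using pos[of k r] neg[of k r] that by (cases "n \<ge> 0") (simp_all add: m_def)
  have stable: "affine_subst (- of_nat (k * m)) (inverse q ^ (k * m)) r \<in> I" if "r \<in> I" for k r
    using mk[OF that, of k] by (simp only: alpha_pow_def power_int_of_nat of_int_of_nat_eq)
  show False
  proof (cases "\<forall>n>0. q ^ n \<noteq> 1")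
    case True
    show False
    proof (rule not_dilation_invariant)
      \<comment> \<open>The factor 1 is the instance \<open>k = 1\<close> of
        \<open>stable\<close>.\<close>
      show "inverse q ^ (1 * m) \<noteq> 0" using assms(1) by simp
      fix n :: nat assume "n > 0"
      then have "q ^ (m * n) \<noteq> 1" using True m by simp
      then show "(inverse q ^ (1 * m)) ^ n \<noteq> 1"
        by (simp add: power_inverse flip: power_mult)
    qed (rule stable)
  next
    case False
    then obtain k where k: "k > 0" "q ^ k = 1" by blast
    have char: "CHAR('k) = 0" using assms(2) False by blast
    show False
    proof (rule not_translation_invariant[OF char])
      show "- of_nat (k * m) \<noteq> (0::'k)"
        using char k m of_nat_eq_0_iff_char_dvd[where 'a = 'k, of "k * m"] by simp
      fix r assume "r \<in> I"
      moreover have "inverse q ^ (k * m) = 1" by (simp add: power_mult power_inverse k)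
      ultimately show "affine_subst (- of_nat (k * m)) 1 r \<in> I" using stable by metis
    qed
  qed
qed

section \<open>The grading of a cyclic module\<close>

lemma alpha_pow_add: "alpha_pow q i (r + s) = alpha_pow q i r + alpha_pow q i s"
  by (simp add: alpha_pow_def affine_subst_add)

lemma alpha_pow_diff: "alpha_pow q i (r - s) = alpha_pow q i r - alpha_pow q i s"
  by (simp add: alpha_pow_def affine_subst_diff)

lemma alpha_pow_mult: "q \<noteq> 0 \<Longrightarrow> alpha_pow q i (r * s) = alpha_pow q i r * alpha_pow q i s"
  by (simp add: alpha_pow_def affine_subst_mult)

lemma alpha_pow_one: "alpha_pow q i 1 = 1"
  by (simp add: alpha_pow_def)

lemma alpha_pow_zero: "alpha_pow q i 0 = 0"
  by (simp add: alpha_pow_def)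

lemma alpha_pow_inverse: "q \<noteq> 0 \<Longrightarrow> alpha_pow q i (alpha_pow q (- i) r) = r"
  by (simp add: alpha_pow_alpha_pow alpha_pow_0)

text \<open>The maximal ideal \<open>\<alpha>\<^sup>i(I)\<close>, written as a preimage.\<close>

definition alpha_image :: "'k::field \<Rightarrow> 'k coord set \<Rightarrow> int \<Rightarrow> 'k coord set"
  where "alpha_image q I i = {r. alpha_pow q (- i) r \<in> I}"

lemma alpha_image_0: "alpha_image q I 0 = I"
  by (simp add: alpha_image_def alpha_pow_0)

lemma alpha_image_alpha_image:
  "q \<noteq> 0 \<Longrightarrow> alpha_image q (alpha_image q I i) j = alpha_image q I (i + j)"
  by (simp add: alpha_image_def alpha_pow_alpha_pow)

lemma (in max_ideal_coord) max_ideal_alpha_image: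
  assumes "q \<noteq> 0"
  shows "max_ideal (alpha_image q I i)"
proof
  fix x assume "x \<notin> alpha_image q I i"
  then obtain y where "alpha_pow q (- i) x * y - 1 \<in> I"
    using inverse_mod by (auto simp: alpha_image_def)
  moreover have "y = alpha_pow q (- i) (alpha_pow q i y)"
    using alpha_pow_inverse[OF assms, of "- i" y] by simp
  ultimately have "alpha_pow q (- i) (x * alpha_pow q i y - 1) \<in> I"
    using assms by (simp add: alpha_pow_diff alpha_pow_mult alpha_pow_one)
  then show "\<exists>y. x * y - 1 \<in> alpha_image q I i" by (auto simp: alpha_image_def)
qed (use assms in \<open>simp_all add: alpha_image_def alpha_pow_add alpha_pow_mult alpha_pow_one
  alpha_pow_zero zero_in add_in mult_in one_notin\<close>)

text \<open>If two images agree, \<open>alpha_pow q (j - i)\<close> stabilizes \<open>I\<close>,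
  against freeness unless the exponent is 0.\<close>

lemma (in max_ideal_coord) alpha_image_inj:
  assumes "q \<noteq> 0" "CHAR('k) = 0 \<or> (\<forall>n>0. q ^ n \<noteq> 1)" "alpha_image q I i = alpha_image q I j"
  shows "i = j"
proof (rule ccontr)
  assume "i \<noteq> j"
  then have "j - i \<noteq> 0" by simp
  then show False
  proof (rule alpha_pow_free[OF assms(1,2)])
    fix r
    have "alpha_pow q j r \<in> alpha_image q I i \<longleftrightarrow> alpha_pow q j r \<in> alpha_image q I j"
      using assms(3) by simp
    then show "alpha_pow q (j - i) r \<in> I \<longleftrightarrow> r \<in> I"
      by (simp add: alpha_image_def alpha_pow_alpha_pow assms(1) alpha_pow_0)
  qed
qed

text \<open>Words are built by letters multiplied from the left, which fits the action on a left
  module.\<close>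

lemma free_induct [case_names scal mult add]:
  fixes f :: "'k::field free"
  assumes scal: "\<And>c. P (scal c)"
    and mult: "\<And>l f. P f \<Longrightarrow> P (gen l * f)"
    and add: "\<And>f g. P f \<Longrightarrow> P g \<Longrightarrow> P (f + g)"
  shows "P f"
proof -
  have single: "P (Poly_Mapping.single w c)" for w and c :: 'k
  proof (induction w)
    case (Cons l w)
    have "gen l * Poly_Mapping.single w c = Poly_Mapping.single (l # w) c"
      by (simp add: mult_single plus_list_def)
    then show ?case using mult[OF Cons, of l] by simp
  qed (rule scal)
  show ?thesis
  proof (induction f rule: update_induct)
    case const
    then show ?case using scal[of 0] by simp
  next
    case (update f w c)
    have "Poly_Mapping.update w c f = f + Poly_Mapping.single w c"
      using update.hyps
      by (intro poly_mapping_eqI) (auto simp: lookup_update lookup_add lookup_single in_keys_iff)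
    then show ?case using add[OF update.IH single] by simp
  qed
qed

section \<open>The action of D on a module, its relations and its grading\<close>

locale D_module = left_module "D_alg q" M
  for q :: "'k::field" and M :: "('k free set, 'm, 'd) module_scheme" (structure) +
  assumes q_nonzero: "q \<noteq> 0"
begin

text \<open>Representatives in the free algebra act instead of cosets, which allows induction over
  words and turns relations into equations between operators.\<close>

definition act :: "'k free \<Rightarrow> 'm \<Rightarrow> 'm"
  where "act f w = (D_ideal q +>\<^bsub>free_ring\<^esub> f) \<odot>\<^bsub>M\<^esub> w"

abbreviation "coef_act r \<equiv> act (gen (Coef r))"
abbreviation "X_act \<equiv> act (gen LX)"
abbreviation "Y_act \<equiv> act (gen LY)"
abbreviation "Y1_act \<equiv> act (gen LY1)"

lemma coset_hom: "(+>\<^bsub>free_ring\<^esub>) (D_ideal q) \<in> ring_hom free_ring (D_alg q)"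
  unfolding D_alg_def by (rule ideal.rcos_ring_hom[OF ideal_D_ideal])

lemma coset_closed: "D_ideal q +>\<^bsub>free_ring\<^esub> f \<in> carrier (D_alg q)"
  using ring_hom_closed[OF coset_hom, of f] by (simp add: ring_of_type_algebra_simps)

lemma coset_surj:
  assumes "d \<in> carrier (D_alg q)"
  obtains f where "d = D_ideal q +>\<^bsub>free_ring\<^esub> f"
  using assms by (auto simp: D_alg_def FactRing_def A_RCOSETS_def')

lemma act_closed: "w \<in> carrier M \<Longrightarrow> act f w \<in> carrier M"
  unfolding act_def by (intro smult_closed coset_closed)

lemma act_r_distr: "\<lbrakk>w \<in> carrier M; w' \<in> carrier M\<rbrakk> \<Longrightarrow> act f (w \<oplus> w') = act f w \<oplus> act f w'"
  unfolding act_def by (intro smult_r_distr coset_closed)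

lemma act_l_distr: "w \<in> carrier M \<Longrightarrow> act (f + g) w = act f w \<oplus> act g w"
  using ring_hom_add[OF coset_hom, of f g]
  by (simp add: act_def ring_of_type_algebra_simps smult_l_distr coset_closed)

lemma act_mult: "w \<in> carrier M \<Longrightarrow> act (f * g) w = act f (act g w)"
  using ring_hom_mult[OF coset_hom, of f g]
  by (simp add: act_def ring_of_type_algebra_simps smult_assoc coset_closed)

lemma act_one: "w \<in> carrier M \<Longrightarrow> act 1 w = w"
  using ring_hom_one[OF coset_hom] by (simp add: act_def ring_of_type_algebra_simps smult_one)

lemma act_zero: "act f \<zero> = \<zero>"
proof -
  have "act f \<zero> \<oplus> act f \<zero> = act f \<zero>" using act_r_distr[of \<zero> \<zero> f] by simp
  then show ?thesis using act_closed[of \<zero> f] M.add.r_cancel_one' by (metis M.zero_closed)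
qed

lemma act_eq_if_relation:
  assumes "f - g \<in> relations q"
  shows "act f = act g"
proof -
  interpret F: ring "free_ring :: 'k free ring" by (rule ring_ring_of_type_algebra)
  have "\<ominus>\<^bsub>free_ring\<^esub> g = - g"
    by (rule F.minus_equality) (simp_all add: ring_of_type_algebra_simps)
  then have "f \<ominus>\<^bsub>free_ring\<^esub> g = f - g"
    by (simp add: F.minus_eq ring_of_type_algebra_simps)
  moreover have "f - g \<in> D_ideal q"
    using F.genideal_self[of "relations q"] assms
    by (auto simp: D_ideal_def ring_of_type_algebra_simps)
  ultimately have "D_ideal q +>\<^bsub>free_ring\<^esub> f = D_ideal q +>\<^bsub>free_ring\<^esub> g"
    using F.quotient_eq_iff_same_a_r_cos[OF ideal_D_ideal, of f g]
    by (simp add: ring_of_type_algebra_simps)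
  then show ?thesis by (simp add: act_def fun_eq_iff)
qed

lemma coef_act_add: "w \<in> carrier M \<Longrightarrow> coef_act (r + s) w = coef_act r w \<oplus> coef_act s w"
  by (subst act_l_distr[symmetric], simp, rule fun_cong[OF act_eq_if_relation])
     (unfold relations_def, blast)

lemma act_act_eq_if_relation:
  "f * g - f' * g' \<in> relations q \<Longrightarrow> w \<in> carrier M \<Longrightarrow> act f (act g w) = act f' (act g' w)"
  using act_eq_if_relation[of "f * g" "f' * g'"] by (simp flip: act_mult)

lemma act_act_eq_if_relation1:
  "f * g - h \<in> relations q \<Longrightarrow> w \<in> carrier M \<Longrightarrow> act f (act g w) = act h w"
  using act_eq_if_relation[of "f * g" h] by (simp flip: act_mult)

lemma coef_act_mult: "w \<in> carrier M \<Longrightarrow> coef_act (r * s) w = coef_act r (coef_act s w)"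
  by (subst act_mult[symmetric], simp, rule fun_cong[OF act_eq_if_relation])
     (unfold relations_def, blast)

lemma act_scal: "act (scal c) = coef_act (const c)"
  by (rule sym, rule act_eq_if_relation) (unfold relations_def, blast)

lemma coef_act_one: "w \<in> carrier M \<Longrightarrow> coef_act 1 w = w"
  using fun_cong[OF act_scal[of 1], of w] act_one[of w] single_one[where 'a = "'k coord letter list" and 'b = 'k]
  by (simp add: zero_list_def)

lemma coef_act_zero: "w \<in> carrier M \<Longrightarrow> coef_act 0 w = \<zero>"
  using coef_act_add[of w 0 0] act_closed[of w "gen (Coef 0)"] M.add.r_cancel_one' by simp

lemma Y_X: "w \<in> carrier M \<Longrightarrow> Y_act (X_act w) = coef_act tau w"
  by (rule act_act_eq_if_relation1) (auto simp: relations_def)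

lemma X_Y: "w \<in> carrier M \<Longrightarrow> X_act (Y_act w) = coef_act (tau - 1) w"
  by (rule act_act_eq_if_relation1) (auto simp: relations_def)

lemma Y1_X: "w \<in> carrier M \<Longrightarrow> Y1_act (X_act w) = coef_act (const q * sigma - 1) w"
  by (rule act_act_eq_if_relation1) (auto simp: relations_def)

lemma X_Y1: "w \<in> carrier M \<Longrightarrow> X_act (Y1_act w) = coef_act (sigma - 1) w"
  by (rule act_act_eq_if_relation1) (auto simp: relations_def)

lemma X_coef: "w \<in> carrier M \<Longrightarrow> X_act (coef_act r w) = coef_act (alpha_pow q 1 r) (X_act w)"
  unfolding alpha_pow_1
  by (rule act_act_eq_if_relation) (unfold relations_def, blast)

lemma Y_coef: "w \<in> carrier M \<Longrightarrow> Y_act (coef_act r w) = coef_act (alpha_pow q (-1) r) (Y_act w)"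
  unfolding alpha_pow_minus_1[OF q_nonzero]
  by (rule act_act_eq_if_relation) (unfold relations_def, blast)

lemma Y1_coef: "w \<in> carrier M \<Longrightarrow> Y1_act (coef_act r w) = coef_act (alpha_pow q (-1) r) (Y1_act w)"
  unfolding alpha_pow_minus_1[OF q_nonzero]
  by (rule act_act_eq_if_relation) (unfold relations_def, blast)

lemma coef_X: "w \<in> carrier M \<Longrightarrow> coef_act r (X_act w) = X_act (coef_act (alpha_pow q (-1) r) w)"
  by (simp add: X_coef alpha_pow_alpha_pow q_nonzero alpha_pow_0)

lemma coef_Y: "w \<in> carrier M \<Longrightarrow> coef_act r (Y_act w) = Y_act (coef_act (alpha_pow q 1 r) w)"
  by (simp add: Y_coef alpha_pow_alpha_pow q_nonzero alpha_pow_0)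

lemma coef_Y1: "w \<in> carrier M \<Longrightarrow> coef_act r (Y1_act w) = Y1_act (coef_act (alpha_pow q 1 r) w)"
  by (simp add: Y1_coef alpha_pow_alpha_pow q_nonzero alpha_pow_0)

lemma coef_commute: "w \<in> carrier M \<Longrightarrow> coef_act r (coef_act s w) = coef_act s (coef_act r w)"
  by (simp flip: coef_act_mult add: mult.commute)

text \<open>
  Only words \<open>r X\<^sup>i\<close> and only words in \<open>Y\<close>, \<open>Y\<^sub>1\<close> are allowed here: since \<open>X\<close> cancels against
  \<open>Y\<close> and \<open>Y\<^sub>1\<close>, they already give all of the degree \<open>i\<close> part of \<open>Dv\<close>.
\<close>

inductive graded :: "'m \<Rightarrow> int \<Rightarrow> 'm \<Rightarrow> bool" for v
  where
    base: "graded v 0 v"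
  | coef: "graded v i w \<Longrightarrow> graded v i (coef_act r w)"
  | add: "graded v i w \<Longrightarrow> graded v i w' \<Longrightarrow> graded v i (w \<oplus> w')"
  | X: "graded v i w \<Longrightarrow> 0 \<le> i \<Longrightarrow> graded v (i + 1) (X_act w)"
  | Y: "graded v i w \<Longrightarrow> i \<le> 0 \<Longrightarrow> graded v (i - 1) (Y_act w)"
  | Y1: "graded v i w \<Longrightarrow> i \<le> 0 \<Longrightarrow> graded v (i - 1) (Y1_act w)"

lemma graded_closed: "graded v i w \<Longrightarrow> v \<in> carrier M \<Longrightarrow> w \<in> carrier M"
  by (induction rule: graded.induct) (auto intro: act_closed)

text \<open>The rules \<open>Y\<close> and \<open>Y1\<close> start in degree at most 0 and end in
  negative degree, so nonnegative degrees are reached from \<open>v\<close> by coefficients, sums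
  and X alone.\<close>

lemma graded_in_if_nonneg:
  assumes "graded v i w" "0 \<le> i" "v \<in> N"
    and "\<And>r w. w \<in> N \<Longrightarrow> coef_act r w \<in> N" "\<And>w. w \<in> N \<Longrightarrow> X_act w \<in> N"
    and "\<And>w w'. \<lbrakk>w \<in> N; w' \<in> N\<rbrakk> \<Longrightarrow> w \<oplus> w' \<in> N"
  shows "w \<in> N"
  using assms(1,2)
  by (induction rule: graded.induct) (use assms(3-6) in auto)

text \<open>Moving a coefficient past a letter twists it by \<alpha> or its inverse, exactly as the
  letter shifts the degree.\<close>

lemma graded_weight:
  assumes "graded v i w" "v \<in> carrier M" "\<And>r. r \<in> I \<Longrightarrow> coef_act r v = \<zero>"
    and "r \<in> alpha_image q I i"
  shows "coef_act r w = \<zero>"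
  using assms(1,4)
proof (induction arbitrary: r rule: graded.induct)
  case base
  then show ?case using assms(3) by (simp add: alpha_image_def alpha_pow_0)
next
  case (coef i w s)
  then have "w \<in> carrier M" using graded_closed assms(2) by blast
  then show ?case using coef by (simp add: coef_commute[of w r s] act_zero)
next
  case (add i w w')
  then have "w \<in> carrier M" "w' \<in> carrier M" using graded_closed assms(2) by blast+
  then show ?case using add by (simp add: act_r_distr)
next
  case (X i w)
  then have "w \<in> carrier M" using graded_closed assms(2) by blast
  moreover have "alpha_pow q (-1) r \<in> alpha_image q I i"
    using X.prems by (simp add: alpha_image_def alpha_pow_alpha_pow q_nonzero)
  ultimately show ?case using X.IH by (simp add: coef_X act_zero)
next
  case (Y i w)
  then have "w \<in> carrier M" using graded_closed assms(2) by blast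
  moreover have "alpha_pow q 1 r \<in> alpha_image q I i"
    using Y.prems by (simp add: alpha_image_def alpha_pow_alpha_pow q_nonzero)
  ultimately show ?case using Y.IH by (simp add: coef_Y act_zero)
next
  case (Y1 i w)
  then have "w \<in> carrier M" using graded_closed assms(2) by blast
  moreover have "alpha_pow q 1 r \<in> alpha_image q I i"
    using Y1.prems by (simp add: alpha_image_def alpha_pow_alpha_pow q_nonzero)
  ultimately show ?case using Y1.IH by (simp add: coef_Y1 act_zero)
qed

text \<open>This removes the side condition of the rule \<open>X\<close>: in negative degree, X
  moves past coefficients and cancels against the outermost Y or \<open>Y\<^sub>1\<close>, leaving a
  coefficient.\<close>

lemma graded_X:
  assumes "graded v i w" "v \<in> carrier M"
  shows "graded v (i + 1) (X_act w)"
proof (cases "0 \<le> i")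
  case False
  with assms(1) show ?thesis
  proof (induction rule: graded.induct)
    case (coef i w r)
    then have "w \<in> carrier M" using graded_closed assms(2) by blast
    then show ?case using coef by (simp add: X_coef graded.coef)
  next
    case (add i w w')
    then have "w \<in> carrier M" "w' \<in> carrier M" using graded_closed assms(2) by blast+
    then show ?case using add by (simp add: act_r_distr graded.add)
  next
    case (Y i w)
    then have "w \<in> carrier M" using graded_closed assms(2) by blast
    then show ?case using Y by (simp add: X_Y graded.coef)
  next
    case (Y1 i w)
    then have "w \<in> carrier M" using graded_closed assms(2) by blast
    then show ?case using Y1 by (simp add: X_Y1 graded.coef)
  qed auto
qed (use assms(1) in \<open>rule graded.X\<close>)

text \<open>Dual to \<open>graded_X\<close>: in positive degree, Y cancels against the outermost
  X.\<close>

lemma graded_Y: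
  assumes "graded v i w" "v \<in> carrier M"
  shows "graded v (i - 1) (Y_act w)"
proof (cases "i \<le> 0")
  case False
  with assms(1) show ?thesis
  proof (induction rule: graded.induct)
    case (coef i w r)
    then have "w \<in> carrier M" using graded_closed assms(2) by blast
    then show ?case using coef by (simp add: Y_coef graded.coef)
  next
    case (add i w w')
    then have "w \<in> carrier M" "w' \<in> carrier M" using graded_closed assms(2) by blast+
    then show ?case using add by (simp add: act_r_distr graded.add)
  next
    case (X i w)
    then have "w \<in> carrier M" using graded_closed assms(2) by blast
    then show ?case using X by (simp add: Y_X graded.coef)
  qed auto
qed (use assms(1) in \<open>rule graded.Y\<close>)

lemma graded_Y1:
  assumes "graded v i w" "v \<in> carrier M"
  shows "graded v (i - 1) (Y1_act w)"
proof (cases "i \<le> 0")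
  case False
  with assms(1) show ?thesis
  proof (induction rule: graded.induct)
    case (coef i w r)
    then have "w \<in> carrier M" using graded_closed assms(2) by blast
    then show ?case using coef by (simp add: Y1_coef graded.coef)
  next
    case (add i w w')
    then have "w \<in> carrier M" "w' \<in> carrier M" using graded_closed assms(2) by blast+
    then show ?case using add by (simp add: act_r_distr graded.add)
  next
    case (X i w)
    then have "w \<in> carrier M" using graded_closed assms(2) by blast
    then show ?case using X by (simp add: Y1_X graded.coef)
  qed auto
qed (use assms(1) in \<open>rule graded.Y1\<close>)

section \<open>The cyclic submodule Dv and its weight vectors\<close>

inductive graded_sum :: "'m \<Rightarrow> 'm \<Rightarrow> bool" for v
  where
    graded: "graded v i w \<Longrightarrow> graded_sum v w"
  | add: "graded_sum v w \<Longrightarrow> graded_sum v w' \<Longrightarrow> graded_sum v (w \<oplus> w')"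

lemma graded_sum_closed: "graded_sum v w \<Longrightarrow> v \<in> carrier M \<Longrightarrow> w \<in> carrier M"
  by (induction rule: graded_sum.induct) (auto intro: graded_closed)

lemma graded_sum_gen:
  assumes "graded_sum v w" "v \<in> carrier M"
  shows "graded_sum v (act (gen l) w)"
  using assms(1)
proof (induction rule: graded_sum.induct)
  case (graded i w)
  then show ?case
    using graded.coef graded_X[OF _ assms(2)] graded_Y[OF _ assms(2)] graded_Y1[OF _ assms(2)]
    by (cases l) (blast intro: graded_sum.graded)+
next
  case (add w w')
  then have "w \<in> carrier M" "w' \<in> carrier M" using graded_sum_closed assms(2) by blast+
  then show ?case using add by (simp add: act_r_distr graded_sum.add)
qed

lemma graded_sum_act:
  assumes "graded_sum v w" "v \<in> carrier M"
  shows "graded_sum v (act f w)"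
proof -
  have w: "w \<in> carrier M" using assms graded_sum_closed by blast
  show ?thesis
  proof (induction f rule: free_induct)
    case (scal c)
    then show ?case unfolding act_scal by (rule graded_sum_gen[OF assms])
  next
    case (mult l f)
    then show ?case by (simp add: act_mult w graded_sum_gen assms(2))
  next
    case (add f g)
    then show ?case by (simp add: act_l_distr w graded_sum.add)
  qed
qed

text \<open>This submodule is Dv; in an irreducible module with nonzero \<open>v\<close> it is
  everything.\<close>

lemma submodule_graded_sum:
  assumes "v \<in> carrier M"
  shows "submodule {w. graded_sum v w} (D_alg q) M"
proof (intro submodule.intro submodule_axioms.intro)
  show "subgroup {w. graded_sum v w} (add_monoid M)"
  proof (rule M.add.subgroupI)
    show "{w. graded_sum v w} \<subseteq> carrier M" using graded_sum_closed assms by blast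
    show "{w. graded_sum v w} \<noteq> {}" using graded_sum.graded[OF graded.base] by blast
    fix w assume w: "w \<in> {w. graded_sum v w}"
    then have wM: "w \<in> carrier M" using graded_sum_closed assms by blast
    have "coef_act (- 1) w \<oplus> w = \<zero>"
      using coef_act_add[OF wM, of "- 1" 1] by (simp add: coef_act_one coef_act_zero wM)
    then have "\<ominus> w = coef_act (- 1) w" using wM by (intro M.minus_equality act_closed)
    then show "\<ominus> w \<in> {w. graded_sum v w}" using w graded_sum_gen assms by simp
  qed (auto intro: graded_sum.add)
  fix d w assume d: "d \<in> carrier (D_alg q)" and w: "w \<in> {w. graded_sum v w}"
  obtain f where "d = D_ideal q +>\<^bsub>free_ring\<^esub> f" by (rule coset_surj[OF d])
  then show "d \<odot>\<^bsub>M\<^esub> w \<in> {w. graded_sum v w}"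
    using graded_sum_act[OF _ assms, of w f] w by (simp add: act_def)
qed

text \<open>Distinct degrees have distinct weights, so at most one degree has weight
  \<open>J\<close>. Some \<open>e\<close> outside \<open>J\<close> kills the summands of all other
  weights, and an inverse of \<open>e\<close> modulo \<open>J\<close> then recovers
  \<open>w\<close>, because \<open>J\<close> kills \<open>w\<close>.\<close>

lemma graded_sum_weight:
  assumes "max_ideal I" "max_ideal J" "CHAR('k) = 0 \<or> (\<forall>n>0. q ^ n \<noteq> 1)"
    and "v \<in> carrier M" "\<And>r. r \<in> I \<Longrightarrow> coef_act r v = \<zero>"
    and "graded_sum v w" "w \<noteq> \<zero>" "\<And>r. r \<in> J \<Longrightarrow> coef_act r w = \<zero>"
  obtains i where "J = alpha_image q I i" "graded v i w"
proof -
  interpret I: max_ideal_coord I using assms(1) by (simp add: max_ideal_coord_def)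
  interpret J: max_ideal_coord J using assms(2) by (simp add: max_ideal_coord_def)
  \<comment> \<open>The alternative \<open>u = \<zero>\<close> covers the case that no
    \<open>alpha_image q I i\<close> equals \<open>J\<close>. Since at most one degree qualifies,
    \<open>Z\<close> is closed under addition.\<close>
  define Z where "Z u \<longleftrightarrow> u = \<zero> \<or> (\<exists>i. J = alpha_image q I i \<and> graded v i u)" for u
  have Z_coef: "Z (coef_act r u)" if "Z u" for r u
    using that by (auto simp: Z_def act_zero intro: graded.coef)
  have Z_closed: "u \<in> carrier M" if "Z u" for u
    using that graded_closed assms(4) by (auto simp: Z_def)
  have Z_add: "Z (u \<oplus> u')" if "Z u" "Z u'" for u u'
    using that Z_closed[OF that(1)] Z_closed[OF that(2)]
      I.alpha_image_inj[OF q_nonzero assms(3)]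
    unfolding Z_def by (metis M.l_zero M.r_zero graded.add)
  \<comment> \<open>A summand of weight \<open>J\<close> takes \<open>e = 1\<close>; one of another
    weight takes \<open>e\<close> from its own maximal ideal, which is not contained in
    \<open>J\<close>. For sums the factors are multiplied, and primality keeps the product outside
    \<open>J\<close>.\<close>
  have "\<exists>e. e \<notin> J \<and> Z (coef_act e w)"
    using assms(6)
  proof (induction rule: graded_sum.induct)
    case (graded i w)
    then have w: "w \<in> carrier M" using graded_closed assms(4) by blast
    show ?case
    proof (cases "J = alpha_image q I i")
      case True
      then show ?thesis
        using J.one_notin w graded by (intro exI[of _ 1]) (auto simp: Z_def coef_act_one)
    next
      case False
      have "max_ideal (alpha_image q I i)" by (rule I.max_ideal_alpha_image[OF q_nonzero])
      then have "\<not> alpha_image q I i \<subseteq> J"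
        using False max_ideal.eq_if_subset assms(2) by blast
      then obtain e where "e \<notin> J" "e \<in> alpha_image q I i" by blast
      then show ?thesis using graded_weight[OF graded assms(4,5)] by (auto simp: Z_def)
    qed
  next
    case (add w w')
    then have w: "w \<in> carrier M" "w' \<in> carrier M" using graded_sum_closed assms(4) by blast+
    from add obtain e e' where e: "e \<notin> J" "Z (coef_act e w)" "e' \<notin> J" "Z (coef_act e' w')"
      by blast
    have "coef_act (e * e') (w \<oplus> w') = coef_act e' (coef_act e w) \<oplus> coef_act e (coef_act e' w')"
      using w by (simp add: act_r_distr act_closed coef_act_mult coef_commute[of w e e'])
    then show ?case using Z_add Z_coef e J.prime_mult by metis
  qed
  then obtain e where e: "e \<notin> J" "Z (coef_act e w)" by blast
  then obtain s where "e * s - 1 \<in> J" using J.inverse_mod by blast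
  then have "coef_act (e * s - 1) w = \<zero>" using assms(8) by blast
  moreover have w: "w \<in> carrier M" using assms(4,6) graded_sum_closed by blast
  ultimately have "coef_act (e * s) w = w"
    using coef_act_add[OF w, of "e * s - 1" 1] by (simp add: coef_act_one)
  then have "Z w" using Z_coef[OF e(2), of s] w by (metis coef_act_mult mult.commute)
  then show ?thesis using assms(7) that by (auto simp: Z_def)
qed

section \<open>Direct sum decompositions of a weight module\<close>

lemma weight_space_iff:
  "w \<in> weight_space q M I \<longleftrightarrow> w \<in> carrier M \<and> (\<forall>r\<in>I. coef_act r w = \<zero>)"
  by (simp add: weight_space_def D_coef_def D_gen_def act_def)

text \<open>Weight vectors generate \<open>M\<close>, so some weight vector lies outside the proper
  summand \<open>N'\<close>. Its component in \<open>N\<close> is nonzero and has the same weight,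
  since both summands are stable under coefficients and meet in \<zero>.\<close>

lemma weight_vector_in_summand:
  assumes "weight_module q M"
    and N: "subgroup N (add_monoid M)" "\<And>r w. w \<in> N \<Longrightarrow> coef_act r w \<in> N"
    and N': "subgroup N' (add_monoid M)" "\<And>r w. w \<in> N' \<Longrightarrow> coef_act r w \<in> N'"
    and "N <+>\<^bsub>M\<^esub> N' = carrier M" "N \<inter> N' = {\<zero>}" "N \<noteq> {\<zero>}"
  obtains v I where "max_ideal I" "v \<in> N" "v \<noteq> \<zero>" "\<And>r. r \<in> I \<Longrightarrow> coef_act r v = \<zero>"
proof -
  have sub: "N \<subseteq> carrier M" "N' \<subseteq> carrier M"
    using subgroup.subset[OF N(1)] subgroup.subset[OF N'(1)] by simp_all
  have "\<exists>I w. maximalideal I (ring_of_type_algebra :: 'k coord ring) \<and> w \<in> weight_space q M I \<and> w \<notin> N'"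
  proof (rule ccontr)
    assume "\<not> ?thesis"
    then have "generate (add_monoid M)
        (\<Union>I\<in>{I. maximalideal I (ring_of_type_algebra :: 'k coord ring)}. weight_space q M I) \<subseteq> N'"
      by (intro M.add.generate_subgroup_incl N') blast
    then have "carrier M \<subseteq> N'" using assms(1) by (simp add: weight_module_def)
    then have "N \<subseteq> {\<zero>}" using sub assms(7) by blast
    then show False using assms(7,8) by blast
  qed
  then obtain I w where I: "maximalideal I (ring_of_type_algebra :: 'k coord ring)"
    and w: "w \<in> weight_space q M I" "w \<notin> N'" by blast
  then obtain a b where ab: "a \<in> N" "b \<in> N'" "w = a \<oplus> b"
    using assms(6) unfolding weight_space_iff set_add_def' by blast
  have abM: "a \<in> carrier M" "b \<in> carrier M" using ab sub by auto
  have "coef_act r a = \<zero>" if "r \<in> I" for r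
  proof -
    have "coef_act r a \<oplus> coef_act r b = \<zero>"
      using w(1) that abM by (simp add: weight_space_iff ab act_r_distr)
    then have "coef_act r a = \<ominus> coef_act r b"
      using abM act_closed by (metis M.minus_equality)
    also have "\<dots> \<in> N'" using subgroup.m_inv_closed[OF N'(1) N'(2)[OF ab(2)]] by (simp add: a_inv_def)
    finally show ?thesis using N(2)[OF ab(1)] assms(7) by blast
  qed
  moreover have "a \<noteq> \<zero>" using w(2) ab abM by auto
  ultimately show ?thesis using that max_ideal_if_maximalideal[OF I] ab(1) by blast
qed

text \<open>Stability under coefficients and X is what submodules over \<open>A_q\<close> and over
  \<open>A_1\<close> share, so this serves both algebras.\<close>

lemma no_X_stable_decomposition:
  assumes "weight_module q M" "irreducible_module (D_alg q) M"
    and "CHAR('k) = 0 \<or> (\<forall>n>0. q ^ n \<noteq> 1)"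
    and N: "subgroup N (add_monoid M)" "\<And>r w. w \<in> N \<Longrightarrow> coef_act r w \<in> N"
      "\<And>w. w \<in> N \<Longrightarrow> X_act w \<in> N"
    and N': "subgroup N' (add_monoid M)" "\<And>r w. w \<in> N' \<Longrightarrow> coef_act r w \<in> N'"
      "\<And>w. w \<in> N' \<Longrightarrow> X_act w \<in> N'"
    and "N <+>\<^bsub>M\<^esub> N' = carrier M" "N \<inter> N' = {\<zero>}"
  shows "N = {\<zero>} \<or> N' = {\<zero>}"
proof (rule ccontr)
  assume "\<not> ?thesis"
  then have nz: "N \<noteq> {\<zero>}" "N' \<noteq> {\<zero>}" by auto
  have sub: "N \<subseteq> carrier M" "N' \<subseteq> carrier M"
    using subgroup.subset[OF N(1)] subgroup.subset[OF N'(1)] by simp_all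
  have "N' <+>\<^bsub>M\<^esub> N = N <+>\<^bsub>M\<^esub> N'"
  proof -
    have "(\<Union>h\<in>N'. \<Union>k\<in>N. {h \<oplus> k}) = (\<Union>h\<in>N'. \<Union>k\<in>N. {k \<oplus> h})"
      using sub by (intro SUP_cong refl arg_cong[where f = "\<lambda>x. {x}"] M.a_comm) auto
    also have "\<dots> = (\<Union>k\<in>N. \<Union>h\<in>N'. {k \<oplus> h})" by (rule SUP_commute)
    finally show ?thesis by (simp add: set_add_def')
  qed
  then have decomp': "N' <+>\<^bsub>M\<^esub> N = carrier M" "N' \<inter> N = {\<zero>}"
    using assms(10,11) by auto
  obtain v I where v: "max_ideal I" "v \<in> N" "v \<noteq> \<zero>" "\<And>r. r \<in> I \<Longrightarrow> coef_act r v = \<zero>"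
    using weight_vector_in_summand[OF assms(1) N(1,2) N'(1,2) assms(10,11) nz(1)] by blast
  obtain v' I' where v': "max_ideal I'" "v' \<in> N'" "v' \<noteq> \<zero>" "\<And>r. r \<in> I' \<Longrightarrow> coef_act r v' = \<zero>"
    using weight_vector_in_summand[OF assms(1) N'(1,2) N(1,2) decomp' nz(2)] by blast
  interpret I: max_ideal_coord I using v(1) by (simp add: max_ideal_coord_def)
  have vM: "v \<in> carrier M" "v' \<in> carrier M" using v v' sub by auto
  have gen: "graded_sum u w" if "u \<in> carrier M" "u \<noteq> \<zero>" "w \<in> carrier M" for u w
  proof -
    have "{w. graded_sum u w} \<noteq> {\<zero>}" using graded_sum.graded[OF graded.base] that by blast
    then show ?thesis
      using assms(2) submodule_graded_sum[OF that(1)] that(3) by (auto simp: irreducible_module_def)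
  qed
  obtain i where i: "I' = alpha_image q I i" "graded v i v'"
    using graded_sum_weight[OF v(1) v'(1) assms(3) vM(1) v(4) gen[OF vM(1) v(3) vM(2)] v'(3,4)]
    by blast
  obtain j where j: "I = alpha_image q I' j" "graded v' j v"
    using graded_sum_weight[OF v'(1) v(1) assms(3) vM(2) v'(4) gen[OF vM(2) v'(3) vM(1)] v(3,4)]
    by blast
  \<comment> \<open>Going from \<open>v\<close> to \<open>v'\<close> and back returns to the weight
    \<open>I\<close>, so \<open>j = - i\<close> and one of the two degrees is nonnegative.\<close>
  have "alpha_image q I (i + j) = alpha_image q I 0"
    by (simp add: alpha_image_0 flip: alpha_image_alpha_image[OF q_nonzero] i(1) j(1))
  then have "i + j = 0" by (rule I.alpha_image_inj[OF q_nonzero assms(3)])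
  then consider "0 \<le> i" | "0 \<le> j" by linarith
  then show False
  proof cases
    case 1
    then have "v' \<in> N"
      using subgroup.m_closed[OF N(1)] by (intro graded_in_if_nonneg[OF i(2) _ v(2) N(2,3)]) auto
    then show False using v' assms(11) by blast
  next
    case 2
    then have "v \<in> N'"
      using subgroup.m_closed[OF N'(1)] by (intro graded_in_if_nonneg[OF j(2) _ v'(2) N'(2,3)]) auto
    then show False using v assms(11) by blast
  qed
qed

section \<open>Restriction to subrings of D\<close>

lemma left_module_subring:
  assumes "subring S (D_alg q)"
  shows "left_module (D_alg q\<lparr>carrier := S\<rparr>) M"
proof -
  interpret S: ring "D_alg q\<lparr>carrier := S\<rparr>" by (rule R.subring_is_ring[OF assms])
  have "S \<subseteq> carrier (D_alg q)" by (rule subringE(1)[OF assms])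
  then show ?thesis
    by unfold_locales
       (auto intro: smult_closed smult_l_distr smult_r_distr smult_assoc smult_one dest: subsetD)
qed

lemma indecomposable_over_subring:
  assumes "weight_module q M" "irreducible_module (D_alg q) M"
    and "CHAR('k) = 0 \<or> (\<forall>n>0. q ^ n \<noteq> 1)"
    and S: "subring S (D_alg q)" "range (D_coef q) \<subseteq> S" "D_gen q LX \<in> S"
  shows "indecomposable_module (D_alg q\<lparr>carrier := S\<rparr>) M"
  unfolding indecomposable_module_def
proof (intro conjI allI impI)
  show "left_module (D_alg q\<lparr>carrier := S\<rparr>) M" by (rule left_module_subring[OF S(1)])
  show "carrier M \<noteq> {\<zero>}" using assms(2) by (simp add: irreducible_module_def)
  have stable: "subgroup N (add_monoid M)" "\<And>r w. w \<in> N \<Longrightarrow> coef_act r w \<in> N"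
    "\<And>w. w \<in> N \<Longrightarrow> X_act w \<in> N"
    if "submodule N (D_alg q\<lparr>carrier := S\<rparr>) M" for N
    using that S(2,3) submodule.smult_closed[OF that] submodule.axioms(1)[OF that]
    by (auto simp: act_def D_coef_def D_gen_def)
  fix N N'
  assume *: "submodule N (D_alg q\<lparr>carrier := S\<rparr>) M \<and> submodule N' (D_alg q\<lparr>carrier := S\<rparr>) M \<and>
    N <+>\<^bsub>M\<^esub> N' = carrier M \<and> N \<inter> N' = {\<zero>}"
  then show "N = {\<zero>} \<or> N' = {\<zero>}"
    by (intro no_X_stable_decomposition[OF assms(1-3)] stable) blast+
qed

end

theorem theorem1:
  fixes q :: "'k::alg_closed_field"
    and M :: "('k free set, 'm) module"
  assumes "q \<noteq> 0"
    and "CHAR('k) = 0 \<or> (\<forall>n>0. q ^ n \<noteq> 1)"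
    and "weight_module q M"
    and "irreducible_module (D_alg q) M"
  shows "indecomposable_module (A_q q) M \<and> indecomposable_module (A_1 q) M"
proof -
  interpret D_module q M
    using assms(1,3) by (simp add: D_module_def D_module_axioms_def weight_module_def)
  have closed: "range (D_coef q) \<union> {D_gen q LX, D_gen q l} \<subseteq> carrier (D_alg q)" for l
    using coset_closed by (auto simp: D_coef_def D_gen_def)
  \<comment> \<open>The letter \<open>l\<close> is \<open>LY1\<close> for \<open>A_q\<close> and
    \<open>LY\<close> for \<open>A_1\<close>.\<close>
  have "indecomposable_module (D_alg q\<lparr>carrier := generate_ring (D_alg q)
      (range (D_coef q) \<union> {D_gen q LX, D_gen q l})\<rparr>) M" for l
    by (rule indecomposable_over_subring[OF assms(3,4,2) R.generate_ring_is_subring[OF closed]])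
       (auto intro: generate_ring.incl)
  then show ?thesis by (simp add: A_q_def A_1_def)
qed

end
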